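(* Let $X=L^\infty(\mathcal P)$ and write $N^{1,\infty}(\mathcal P)=N^1L^\infty(\mathcal P)$ and $C_\infty=C_{L^\infty}$. Assume that $L^\infty$-almost no nonconstant rectifiable curve exists in $\mathcal P$, i.e. the family of all nonconstant rectifiable curves in $\mathcal P$ has zero $L^\infty$-modulus, and that there is a point $x_0\in\mathcal P$ with $\mu(\{x_0\})=0$. Then $N^{1,\infty}(\mathcal P)=L^\infty(\mathcal P)$ and: (a) $\chi_{\{x_0\}}\in N^{1,\infty}(\mathcal P)$ is weakly quasicontinuous but not quasicontinuous; (b) $C_\infty$ is not an outer capacity, not even for sets of zero capacity; (c) if there is a closed set $F\subset\mathcal P$ with empty interior and $\mu(F)>0$, then $\chi_F\in N^{1,\infty}(\mathcal P)$ is not weakly quasicontinuous. In particular, all of (a)–(c) hold when $\mathcal P$ is the von Koch snowflake curve (with the Euclidean metric) equipped with the $\frac{\log 4}{\log 3}$-dimensional Hausdorff measure.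
   Context: Standing assumptions: $\mathcal P=(\mathcal P,d,\mu)$ is a metric space with a positive complete Borel measure $\mu$ such that $0<\mu(B)<\infty$ for every ball $B$; $\mu$ is extended as an outer measure to all subsets of $\mathcal P$. A curve is a continuous map from a compact interval; rectifiable curves are parametrized by arc length. For a function lattice $X$ of everywhere-defined measurable functions with quasinorm $\|\cdot\|_X$, a family $\Gamma$ of curves has zero $X$-modulus if there is a Borel $\rho\in X$ with $\int_\gamma\rho\,ds=\infty$ for all $\gamma\in\Gamma$. A Borel $g:\mathcal P\to[0,\infty]$ is an upper gradient of $u:\mathcal P\to[-\infty,\infty]$ if $|u(\gamma(0))-u(\gamma(l_\gamma))|\le\int_\gamma g\,ds$ for every nonconstant rectifiable curve $\gamma:[0,l_\gamma]\to\mathcal P$ (with $|(\pm\infty)-(\pm\infty)|=\infty$). The Newtonian space is $N^1X(\mathcal P)=\{u\in X:\|u\|_{N^1X}:=\|u\|_X+\inf_g\|g\|_X<\infty\}$, infimum over upper gradients $g$ of $u$. The capacity is $C_X(E)=\inf\{\|u\|_{N^1X}:u\in N^1X,\ u\ge1 \text{ on } E\}$. A function $u:\mathcal P\to[-\infty,\infty]$ is weakly quasicontinuous if for every $\varepsilon>0$ there is $E\subset\mathcal P$ with $C_X(E)<\varepsilon$ such that $u|_{\mathcal P\setminus E}$ is (real-valued) continuous; it is quasicontinuous if $E$ can moreover be chosen open. $C_X$ is an outer capacity if $C_X(E)=\inf\{C_X(G):G\supset E \text{ open}\}$ for all $E$; it is an outer capacity for sets of zero capacity if whenever $C_X(E)=0$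 and $\varepsilon>0$ there is an open $G\supset E$ with $C_X(G)<\varepsilon$. *)

theory Defs
  imports "HOL-Analysis.Analysis" "HOL-Probability.Essential_Supremum"
begin

definition curve_length :: "(real \<Rightarrow> 'a::metric_space) \<Rightarrow> real \<Rightarrow> real \<Rightarrow> ereal" where
  "curve_length \<gamma> a b =
     (SUP p \<in> {p :: nat \<times> (nat \<Rightarrow> real). snd p 0 = a \<and> snd p (fst p) = b
                   \<and> (\<forall>i<fst p. snd p i \<le> snd p (Suc i))}.
        ereal (\<Sum>i<fst p. dist (\<gamma> (snd p i)) (\<gamma> (snd p (Suc i)))))"

definition arclength_curve :: "'a::metric_space set \<Rightarrow> (real \<Rightarrow> 'a) \<Rightarrow> real \<Rightarrow> bool" where
  "arclength_curve P \<gamma> l \<longleftrightarrow> 0 \<le> l \<and> continuous_on {0..l} \<gamma> \<and> \<gamma> ` {0..l} \<subseteq> P \<and>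
     (\<forall>s t. 0 \<le> s \<and> s \<le> t \<and> t \<le> l \<longrightarrow> curve_length \<gamma> s t = ereal (t - s))"

definition nonconst_rect_curves :: "'a::metric_space set \<Rightarrow> ((real \<Rightarrow> 'a) \<times> real) set" where
  "nonconst_rect_curves P = {(\<gamma>, l). arclength_curve P \<gamma> l \<and> 0 < l}"

definition line_integral :: "('a \<Rightarrow> ennreal) \<Rightarrow> (real \<Rightarrow> 'a) \<times> real \<Rightarrow> ennreal" where
  "line_integral \<rho> c = (\<integral>\<^sup>+ t \<in> {0..snd c}. \<rho> (fst c t) \<partial>lborel)"

definition linf_norm :: "'a measure \<Rightarrow> ('a \<Rightarrow> ereal) \<Rightarrow> ereal" where
  "linf_norm M f = esssup M (\<lambda>x. \<bar>f x\<bar>)"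

definition in_Linf :: "'a measure \<Rightarrow> ('a \<Rightarrow> ereal) \<Rightarrow> bool" where
  "in_Linf M f \<longleftrightarrow> f \<in> borel_measurable M \<and> linf_norm M f < \<infinity>"

definition borel_on :: "'a::metric_space set \<Rightarrow> ('a \<Rightarrow> ennreal) \<Rightarrow> bool" where
  "borel_on P \<rho> \<longleftrightarrow> \<rho> \<in> borel_measurable (restrict_space borel P)"

definition zero_Linf_modulus ::
    "'a::metric_space set \<Rightarrow> 'a measure \<Rightarrow> ((real \<Rightarrow> 'a) \<times> real) set \<Rightarrow> bool" where
  "zero_Linf_modulus P M \<Gamma> \<longleftrightarrow>
     (\<exists>\<rho>. borel_on P \<rho> \<and> in_Linf M (\<lambda>x. enn2ereal (\<rho> x)) \<and> (\<forall>c\<in>\<Gamma>. line_integral \<rho> c = \<infinity>))"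

definition ediff :: "ereal \<Rightarrow> ereal \<Rightarrow> ereal" where
  "ediff a b = (if \<bar>a\<bar> = \<infinity> \<or> \<bar>b\<bar> = \<infinity> then \<infinity> else \<bar>a - b\<bar>)"

definition upper_gradient :: "'a::metric_space set \<Rightarrow> ('a \<Rightarrow> ereal) \<Rightarrow> ('a \<Rightarrow> ennreal) \<Rightarrow> bool" where
  "upper_gradient P u g \<longleftrightarrow> borel_on P g \<and>
     (\<forall>c\<in>nonconst_rect_curves P.
        ediff (u (fst c 0)) (u (fst c (snd c))) \<le> enn2ereal (line_integral g c))"

definition N1_norm :: "'a::metric_space set \<Rightarrow> 'a measure \<Rightarrow> ('a \<Rightarrow> ereal) \<Rightarrow> ereal" where
  "N1_norm P M u = linf_norm M u +
     (INF g \<in> {g. upper_gradient P u g}. linf_norm M (\<lambda>x. enn2ereal (g x)))"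

definition N1Linf :: "'a::metric_space set \<Rightarrow> 'a measure \<Rightarrow> ('a \<Rightarrow> ereal) set" where
  "N1Linf P M = {u. in_Linf M u \<and> N1_norm P M u < \<infinity>}"

definition Linf :: "'a measure \<Rightarrow> ('a \<Rightarrow> ereal) set" where
  "Linf M = {u. in_Linf M u}"

definition cap_inf :: "'a::metric_space set \<Rightarrow> 'a measure \<Rightarrow> 'a set \<Rightarrow> ereal" where
  "cap_inf P M E = (INF u \<in> {u \<in> N1Linf P M. \<forall>x\<in>E. 1 \<le> u x}. N1_norm P M u)"

definition weakly_quasicont :: "'a::metric_space set \<Rightarrow> 'a measure \<Rightarrow> ('a \<Rightarrow> ereal) \<Rightarrow> bool" where
  "weakly_quasicont P M u \<longleftrightarrow> (\<forall>\<epsilon>>0. \<exists>E. E \<subseteq> P \<and> cap_inf P M E < ereal \<epsilon> \<and>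
      (\<forall>x\<in>P - E. \<bar>u x\<bar> \<noteq> \<infinity>) \<and> continuous_on (P - E) u)"

definition quasicont :: "'a::metric_space set \<Rightarrow> 'a measure \<Rightarrow> ('a \<Rightarrow> ereal) \<Rightarrow> bool" where
  "quasicont P M u \<longleftrightarrow> (\<forall>\<epsilon>>0. \<exists>E. openin (top_of_set P) E \<and> cap_inf P M E < ereal \<epsilon> \<and>
      (\<forall>x\<in>P - E. \<bar>u x\<bar> \<noteq> \<infinity>) \<and> continuous_on (P - E) u)"

definition outer_capacity :: "'a::metric_space set \<Rightarrow> 'a measure \<Rightarrow> bool" where
  "outer_capacity P M \<longleftrightarrow> (\<forall>E. E \<subseteq> P \<longrightarrow>
      cap_inf P M E = (INF G \<in> {G. openin (top_of_set P) G \<and> E \<subseteq> G}. cap_inf P M G))"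

definition outer_capacity_zero_sets :: "'a::metric_space set \<Rightarrow> 'a measure \<Rightarrow> bool" where
  "outer_capacity_zero_sets P M \<longleftrightarrow> (\<forall>E. E \<subseteq> P \<longrightarrow> cap_inf P M E = 0 \<longrightarrow>
      (\<forall>\<epsilon>>0. \<exists>G. openin (top_of_set P) G \<and> E \<subseteq> G \<and> cap_inf P M G < ereal \<epsilon>))"

definition standing_assms :: "'a::metric_space set \<Rightarrow> 'a measure \<Rightarrow> bool" where
  "standing_assms P M \<longleftrightarrow> space M = P \<and> sets (restrict_space borel P) \<subseteq> sets M \<and>
     complete_measure M \<and>
     (\<forall>x\<in>P. \<forall>r>0. 0 < emeasure M (ball x r \<inter> P) \<and> emeasure M (ball x r \<inter> P) < \<infinity>)"

definition concl_abc :: "'a::metric_space set \<Rightarrow> 'a measure \<Rightarrow> 'a \<Rightarrow> bool" where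
  "concl_abc P M x0 \<longleftrightarrow>
     (indicator {x0} \<in> N1Linf P M \<and> weakly_quasicont P M (indicator {x0})
        \<and> \<not> quasicont P M (indicator {x0})) \<and>
     (\<not> outer_capacity P M \<and> \<not> outer_capacity_zero_sets P M) \<and>
     (\<forall>F. closedin (top_of_set P) F \<and> (top_of_set P) interior_of F = {} \<and> 0 < emeasure M F \<longrightarrow>
        indicator F \<in> N1Linf P M \<and> \<not> weakly_quasicont P M (indicator F))"

definition hausdorff_delta :: "real \<Rightarrow> real \<Rightarrow> 'a::metric_space set \<Rightarrow> ennreal" where
  "hausdorff_delta s \<delta> A = (INF U \<in> {U :: nat \<Rightarrow> 'a set. A \<subseteq> (\<Union>n. U n) \<and>
       (\<forall>n. bounded (U n) \<and> diameter (U n) \<le> \<delta>)}. (\<Sum>n. ennreal (diameter (U n) powr s)))"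

definition hausdorff_outer :: "real \<Rightarrow> 'a::metric_space set \<Rightarrow> ennreal" where
  "hausdorff_outer s A = (SUP \<delta> \<in> {0<..}. hausdorff_delta s \<delta> A)"

definition hausdorff_measure_on :: "real \<Rightarrow> 'a::metric_space set \<Rightarrow> 'a measure" where
  "hausdorff_measure_on s K =
     completion (measure_of K (sets (restrict_space borel K)) (hausdorff_outer s))"

definition koch_maps :: "(complex \<Rightarrow> complex) set" where
  "koch_maps = {\<lambda>z. z / 3, \<lambda>z. 1/3 + cis (pi/3) * z / 3,
                \<lambda>z. cis (pi/3) / 3 + 1/3 + cis (-pi/3) * z / 3, \<lambda>z. 2/3 + z / 3}"

inductive_set koch_points :: "complex set" where
  zero: "0 \<in> koch_points"
| one: "1 \<in> koch_points"
| step: "z \<in> koch_points \<Longrightarrow> f \<in> koch_maps \<Longrightarrow> f z \<in> koch_points"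

definition koch_curve :: "complex set" where
  "koch_curve = closure koch_points"

definition koch_snowflake :: "complex set" where
  "koch_snowflake = koch_curve \<union> (\<lambda>z. 1 + cis (-2*pi/3) * z) ` koch_curve
                     \<union> (\<lambda>z. cis (-pi/3) + cis (2*pi/3) * z) ` koch_curve"

end

theory Submission
  imports Defs
begin

text \<open>If almost no nonconstant rectifiable curve exists, then there is an essentially bounded function with infinite
  integral along each of them, and all its positive multiples are upper gradients of every function. Hence the Newtonian norm is the
  essential supremum norm, sets of measure zero have capacity zero, and a set of capacity less than
  one lies in a null set. A nonempty open set has positive measure, hence capacity at least one,
  and (a)--(c) follow.

  For the snowflake, the Hausdorff measure is a Borel measure by Caratheodory's criterion and is finite
  by self-similarity. The inverse of the parametrization of the Koch curve over \<open>[0,1]\<close> is Hoelder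
  continuous with exponent \<open>s = log 4 / log 3\<close>. This bounds the measure of balls from below by
  Lebesgue measure. Since \<open>s > 1\<close>, it also shows that a Lipschitz curve in the Koch curve is constant, so
  that the snowflake contains no nonconstant rectifiable curve at all.\<close>

section \<open>Capacity when almost no curve exists\<close>

text \<open>The recursion behind the Hoelder estimate loses nothing:
  \<open>3 powr koch_dim = 4\<close>, so passing to one of the four pieces divides parameter
  differences by 4 and the \<open>koch_dim\<close>-th power of distances by the same factor. Only
  points in different pieces need geometry. The obstacle is a pair of touching pieces, whose points
  may be arbitrarily close. There the real parts bound the distance from one of the two points to
  the common vertex by a multiple of the mutual distance, the triangle inequality gives the same for
  the other point, and estimates at the endpoints of the curve finish. The constant 128 comes from
  this case. The parametrization is never given as a function. It is the closure of a set of pairs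
  (point, parameter), so that the Hoelder bound, a closed condition, passes to the limit. That a
  parameter determines its point is a separate fact, obtained by comparing base-4
  expansions.\<close>

lemma linf_norm_nonneg:
  assumes "emeasure M (space M) \<noteq> 0"
  shows "0 \<le> linf_norm M f"
proof -
  have "esssup M (\<lambda>x. 0::ereal) \<le> esssup M (\<lambda>x. \<bar>f x\<bar>)"
    by (rule esssup_AE_mono) auto
  then show ?thesis
    using assms by (simp add: linf_norm_def esssup_const)
qed

lemma linf_norm_cmult:
  assumes "0 < (c::real)"
  shows "linf_norm M (\<lambda>x. enn2ereal (ennreal c * \<rho> x)) = ereal c * linf_norm M (\<lambda>x. enn2ereal (\<rho> x))"
  using esssup_cmult[OF assms, of M "\<lambda>x. enn2ereal (\<rho> x)"] assms
  by (simp add: linf_norm_def times_ennreal.rep_eq)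

lemma in_Linf_indicator:
  assumes "A \<in> sets M"
  shows "in_Linf M (indicator A)"
proof -
  have "linf_norm M (indicator A) \<le> 1"
    unfolding linf_norm_def using assms
    by (intro esssup_I) (auto simp: indicator_def)
  then show ?thesis
    using assms le_less_trans[of _ 1 "\<infinity>::ereal"] by (auto simp: in_Linf_def)
qed

lemma linf_norm_indicator_null:
  assumes "A \<in> null_sets M"
  shows "linf_norm M (indicator A) \<le> 0"
  unfolding linf_norm_def
proof (rule esssup_I)
  show "AE x in M. \<bar>indicator A x :: ereal\<bar> \<le> 0"
    using AE_not_in[OF assms] by eventually_elim simp
qed (use assms in auto)

text \<open>Nonemptiness gives \<open>M\<close> positive total mass, which keeps essential suprema
  of absolute values nonnegative; over a null space a measurable function has essential supremum
  minus infinity.\<close>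

locale almost_no_curves =
  fixes P :: "'a::metric_space set" and M :: "'a measure"
  assumes standing: "standing_assms P M"
    and modulus: "zero_Linf_modulus P M (nonconst_rect_curves P)"
    and nonempty: "P \<noteq> {}"
begin

lemma space_eq: "space M = P"
  using standing by (simp add: standing_assms_def)

lemma openin_sets: "openin (top_of_set P) G \<Longrightarrow> G \<in> sets M"
  using standing
  by (fastforce simp: standing_assms_def sets_restrict_space openin_open)

lemma closedin_sets: "closedin (top_of_set P) F \<Longrightarrow> F \<in> sets M"
  using standing
  by (fastforce simp: standing_assms_def sets_restrict_space closedin_closed)

text \<open>A point of \<open>G\<close> would bring along a whole ball, of positive measure. The
  null set may be larger than \<open>G\<close>, because small capacity only yields containment in
  some null set.\<close>

lemma openin_null_imp_empty:
  assumes "openin (top_of_set P) G" "N \<in> null_sets M" "G \<subseteq> N"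
  shows "G = {}"
proof (rule ccontr)
  assume "G \<noteq> {}"
  then obtain x where x: "x \<in> G" by auto
  then obtain r where r: "r > 0" "ball x r \<inter> P \<subseteq> G"
    using assms(1) by (auto simp: openin_contains_ball)
  have "x \<in> P" using x assms(1) openin_imp_subset by blast
  then have "0 < emeasure M (ball x r \<inter> P)"
    using standing r by (simp add: standing_assms_def)
  also have "\<dots> \<le> emeasure M N"
    using r assms by (intro emeasure_mono) auto
  finally show False
    using assms(2) by (simp add: null_sets_def)
qed

lemma space_pos: "emeasure M (space M) \<noteq> 0"
  using openin_null_imp_empty[of P P] nonempty openin_sets[of P]
  by (auto simp: space_eq null_sets_def)

lemma N1_norm_eq_linf_norm: "N1_norm P M u = linf_norm M u"
proof -
  obtain \<rho> where \<rho>: "borel_on P \<rho>" "in_Linf M (\<lambda>x. enn2ereal (\<rho> x))"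
      "\<And>c. c \<in> nonconst_rect_curves P \<Longrightarrow> line_integral \<rho> c = \<infinity>"
    using modulus by (auto simp: zero_Linf_modulus_def)
  define L where "L = linf_norm M (\<lambda>x. enn2ereal (\<rho> x))"
  have "0 \<le> L" "L < \<infinity>"
    using \<rho>(2) linf_norm_nonneg[OF space_pos] by (auto simp: L_def in_Linf_def)
  then obtain l where l: "L = ereal l" "0 \<le> l"
    by (cases L) auto
  let ?I = "INF g \<in> {g. upper_gradient P u g}. linf_norm M (\<lambda>x. enn2ereal (g x))"
  have "?I \<le> 0 + ereal e" if "0 < e" for e :: real
  proof -
    \<comment> \<open>The \<open>+ 1\<close> keeps the denominator positive when \<open>l\<close> is
      0.\<close>
    define c where "c = e / (l + 1)"
    have c: "0 < c" "c * l \<le> e"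
      using that l by (auto simp: c_def field_simps)
    have li: "line_integral (\<lambda>x. ennreal c * \<rho> x) \<gamma> = \<infinity>" if \<gamma>: "\<gamma> \<in> nonconst_rect_curves P" for \<gamma>
    proof -
      obtain g r where g: "\<gamma> = (g, r)" "arclength_curve P g r"
        using \<gamma> by (auto simp: nonconst_rect_curves_def)
      \<comment> \<open>Pulling \<open>c\<close> out of the integral needs measurability of
        \<open>\<rho>\<close> along the curve. As \<open>\<rho>\<close> is Borel only on
        \<open>P\<close>, the curve is treated as a measurable map into that subspace.\<close>
      have "continuous_on {0..r} g" "g \<in> {0..r} \<rightarrow> P"
        using g by (auto simp: arclength_curve_def)
      have "g \<in> borel_measurable (restrict_space lborel {0..r})"
        using borel_measurable_continuous_on_restrict[OF \<open>continuous_on {0..r} g\<close>]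
        by (simp add: measurable_def sets_restrict_space space_restrict_space)
      then have "g \<in> restrict_space lborel {0..r} \<rightarrow>\<^sub>M restrict_space borel P"
        using \<open>g \<in> {0..r} \<rightarrow> P\<close> by (intro measurable_restrict_space2) (auto simp: space_restrict_space)
      then have "(\<lambda>x. \<rho> (g x)) \<in> borel_measurable (restrict_space lborel {0..r})"
        using \<rho>(1) unfolding borel_on_def by (rule measurable_compose)
      then have "(\<lambda>x. \<rho> (g x) * indicator {0..r} x) \<in> borel_measurable lborel"
        by (simp add: borel_measurable_restrict_space_iff_ennreal)
      then have "line_integral (\<lambda>x. ennreal c * \<rho> x) \<gamma> = ennreal c * line_integral \<rho> \<gamma>"
        unfolding line_integral_def g(1)
        by (simp add: nn_integral_cmult[symmetric] mult.assoc)
      then show ?thesis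
        using \<rho>(3)[OF \<gamma>] c by (simp add: ennreal_mult_top)
    qed
    \<comment> \<open>An infinite integral dominates every \<open>ediff\<close>, including the value
      infinity it takes when \<open>u\<close> is infinite at an endpoint.\<close>
    have "upper_gradient P u (\<lambda>x. ennreal c * \<rho> x)"
      using \<rho>(1) li by (auto simp: upper_gradient_def borel_on_def)
    then have "?I \<le> linf_norm M (\<lambda>x. enn2ereal (ennreal c * \<rho> x))"
      by (intro INF_lower) simp
    also have "\<dots> \<le> 0 + ereal e"
      using c l(1) by (simp add: linf_norm_cmult[OF c(1)] L_def[symmetric])
    finally show ?thesis .
  qed
  then have "?I \<le> 0"
    by (blast intro: ereal_le_epsilon2)
  moreover have "0 \<le> ?I"
    by (intro INF_greatest linf_norm_nonneg space_pos)
  ultimately have "?I = 0"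
    by (rule antisym)
  then show ?thesis
    by (simp only: N1_norm_def) simp
qed

lemma N1Linf_eq_Linf: "N1Linf P M = Linf M"
  by (auto simp: N1Linf_def Linf_def N1_norm_eq_linf_norm in_Linf_def)

section \<open>Capacity and null sets\<close>

lemma cap_inf_null:
  assumes "E \<in> null_sets M"
  shows "cap_inf P M E = 0"
proof (rule antisym)
  have "indicator E \<in> N1Linf P M"
    using in_Linf_indicator assms by (auto simp: N1Linf_eq_Linf Linf_def)
  then have "cap_inf P M E \<le> N1_norm P M (indicator E)"
    unfolding cap_inf_def by (intro INF_lower) auto
  then show "cap_inf P M E \<le> 0"
    using linf_norm_indicator_null[OF assms] by (simp add: N1_norm_eq_linf_norm)
  show "0 \<le> cap_inf P M E"
    unfolding cap_inf_def N1_norm_eq_linf_norm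
    by (intro INF_greatest linf_norm_nonneg space_pos)
qed

text \<open>A test function of norm below 1 that is at least 1 on \<open>E\<close> exceeds its
  essential supremum everywhere on \<open>E\<close>, and the set where this happens is null.\<close>

lemma cap_inf_less_1:
  assumes "cap_inf P M E < 1" "E \<subseteq> P"
  obtains N where "N \<in> null_sets M" "E \<subseteq> N"
proof -
  obtain u where u: "u \<in> N1Linf P M" "\<forall>x\<in>E. 1 \<le> u x" "linf_norm M u < 1"
    using assms(1) by (auto simp: cap_inf_def INF_less_iff N1_norm_eq_linf_norm)
  have [measurable]: "u \<in> borel_measurable M"
    using u(1) by (simp add: N1Linf_eq_Linf Linf_def in_Linf_def)
  have "{x \<in> space M. \<bar>u x\<bar> > linf_norm M u} \<in> null_sets M"
    using esssup_zero_measure[of M "\<lambda>x. \<bar>u x\<bar>"]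
    by (auto simp: linf_norm_def intro!: null_setsI)
  moreover have "linf_norm M u < \<bar>u x\<bar>" if "x \<in> E" for x
  proof -
    have "linf_norm M u < 1" "1 \<le> u x" using u that by auto
    moreover have "u x \<le> \<bar>u x\<bar>" by (cases "u x") auto
    ultimately show ?thesis by order
  qed
  ultimately show thesis
    using that assms(2) by (auto simp: space_eq subset_iff)
qed

lemma openin_cap_inf_less_1:
  assumes "openin (top_of_set P) G" "cap_inf P M G < 1"
  shows "G = {}"
  using cap_inf_less_1[OF assms(2)] openin_null_imp_empty[OF assms(1)]
    openin_imp_subset[OF assms(1)] by metis

section \<open>Quasicontinuity of indicator functions\<close>

lemma weakly_quasicont_indicator_null:
  assumes "A \<in> null_sets M"
  shows "weakly_quasicont P M (indicator A)"
  unfolding weakly_quasicont_def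
proof (intro allI impI exI[of _ A] conjI)
  have "continuous_on (P - A) (\<lambda>_. 0 :: ereal)" by simp
  then show "continuous_on (P - A) (indicator A :: 'a \<Rightarrow> ereal)"
    by (rule continuous_on_eq) simp
qed (use assms cap_inf_null space_eq sets.sets_into_space in \<open>auto dest!: null_setsD2\<close>)

text \<open>Already for tolerance 1 an open exceptional set is empty, so the indicator would be
  continuous on all of \<open>P\<close>, and \<open>A\<close>, where it is positive, would be a
  nonempty open null set.\<close>

lemma not_quasicont_indicator_null:
  assumes "A \<in> null_sets M" "A \<noteq> {}"
  shows "\<not> quasicont P M (indicator A)"
proof
  assume "quasicont P M (indicator A)"
  then obtain E where "openin (top_of_set P) E" "cap_inf P M E < ereal 1"
      "continuous_on (P - E) (indicator A :: 'a \<Rightarrow> ereal)"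
    unfolding quasicont_def by (meson zero_less_one)
  then have "continuous_on P (indicator A :: 'a \<Rightarrow> ereal)"
    using openin_cap_inf_less_1[of E] by (auto simp: one_ereal_def)
  then have "openin (top_of_set P) (P \<inter> (indicator A :: 'a \<Rightarrow> ereal) -` {0<..})"
    by (rule continuous_openin_preimage_gen) simp
  moreover have "P \<inter> (indicator A :: 'a \<Rightarrow> ereal) -` {0<..} = A"
    using assms(1) space_eq sets.sets_into_space by (fastforce dest: null_setsD2 split: split_indicator_asm)
  ultimately show False
    using openin_null_imp_empty assms by auto
qed

text \<open>The exceptional set lies in a null set and cannot cover \<open>F\<close>. Near a
  remaining point of \<open>F\<close> the indicator is positive off the exceptional set; the part of
  this neighbourhood outside \<open>F\<close> is open and contained in a null set, hence empty,
  which makes the point interior to \<open>F\<close>.\<close>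

lemma not_weakly_quasicont_indicator:
  assumes F: "closedin (top_of_set P) F" "(top_of_set P) interior_of F = {}" "0 < emeasure M F"
  shows "\<not> weakly_quasicont P M (indicator F)"
proof
  assume "weakly_quasicont P M (indicator F)"
  then obtain E where E: "E \<subseteq> P" "cap_inf P M E < ereal 1"
      "continuous_on (P - E) (indicator F :: 'a \<Rightarrow> ereal)"
    unfolding weakly_quasicont_def by (meson zero_less_one)
  obtain N where N: "N \<in> null_sets M" "E \<subseteq> N"
    using cap_inf_less_1 E by (metis one_ereal_def)
  have "\<not> F \<subseteq> N"
  proof
    assume "F \<subseteq> N"
    then have "emeasure M F \<le> emeasure M N"
      using N by (intro emeasure_mono) auto
    then show False using F(3) N by (simp add: null_sets_def)
  qed
  then obtain x where x: "x \<in> F" "x \<notin> E" using N by auto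
  have "F \<subseteq> P" using F(1) closedin_subset by fastforce
  have "openin (top_of_set (P - E)) ((P - E) \<inter> (indicator F :: 'a \<Rightarrow> ereal) -` {0<..})"
    using E(3) by (rule continuous_openin_preimage_gen) simp
  then obtain V where V: "open V" "(P - E) \<inter> (indicator F :: 'a \<Rightarrow> ereal) -` {0<..} = (P - E) \<inter> V"
    by (auto simp: openin_open)
  have VF: "(P - E) \<inter> V \<subseteq> F"
    using V(2) by (fastforce split: split_indicator_asm)
  have "openin (top_of_set P) (P \<inter> V - F)"
    using V(1) F(1) by (intro openin_diff) auto
  moreover have "P \<inter> V - F \<subseteq> N"
    using VF N by auto
  ultimately have "P \<inter> V \<subseteq> F"
    using openin_null_imp_empty N(1) by blast
  moreover have "x \<in> P \<inter> V"
    using x V(2) \<open>F \<subseteq> P\<close> by (auto simp: set_eq_iff)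
  moreover have "openin (top_of_set P) (P \<inter> V)"
    using V(1) by auto
  ultimately have "x \<in> (top_of_set P) interior_of F"
    unfolding interior_of_def by blast
  then show False
    using F(2) by auto
qed

lemma concl_abc:
  assumes "x0 \<in> P" "emeasure M {x0} = 0"
  shows "concl_abc P M x0"
proof -
  have "closedin (top_of_set P) {x0}"
    using assms(1) by simp
  then have null: "{x0} \<in> null_sets M"
    using closedin_sets assms(2) by (blast intro: null_setsI)
  have "indicator F \<in> N1Linf P M" if "closedin (top_of_set P) F" for F
    using in_Linf_indicator[OF closedin_sets[OF that]] by (simp add: N1Linf_eq_Linf Linf_def)
  moreover have nozero: "\<not> outer_capacity_zero_sets P M"
  proof
    assume "outer_capacity_zero_sets P M"
    then obtain G where "openin (top_of_set P) G" "{x0} \<subseteq> G" "cap_inf P M G < ereal 1"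
      unfolding outer_capacity_zero_sets_def
      using assms(1) cap_inf_null[OF null] by (meson empty_subsetI insert_subset zero_less_one)
    then show False
      using openin_cap_inf_less_1 by (auto simp: one_ereal_def)
  qed
  moreover have "\<not> outer_capacity P M"
  proof
    assume "outer_capacity P M"
    \<comment> \<open>When the capacity of \<open>E\<close> is 0, the infimum over open supersets is
      0 as well, so some open superset is below any tolerance.\<close>
    have "outer_capacity_zero_sets P M"
      unfolding outer_capacity_zero_sets_def
    proof (intro allI impI)
      fix E and \<epsilon> :: real
      assume E: "E \<subseteq> P" "cap_inf P M E = 0" "\<epsilon> > 0"
      then have "(INF G \<in> {G. openin (top_of_set P) G \<and> E \<subseteq> G}. cap_inf P M G) < ereal \<epsilon>"
        using \<open>outer_capacity P M\<close> by (metis outer_capacity_def ereal_less(2))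
      then show "\<exists>G. openin (top_of_set P) G \<and> E \<subseteq> G \<and> cap_inf P M G < ereal \<epsilon>"
        by (auto simp: INF_less_iff)
    qed
    with nozero show False ..
  qed
  ultimately show ?thesis
    unfolding concl_abc_def
    using weakly_quasicont_indicator_null[OF null] not_quasicont_indicator_null[OF null]
      not_weakly_quasicont_indicator \<open>closedin (top_of_set P) {x0}\<close> by auto
qed

end

section \<open>Hausdorff measure\<close>

lemma diameter_le_dist:
  fixes S :: "'a::metric_space set"
  assumes "0 \<le> \<delta>" "\<And>x y. x \<in> S \<Longrightarrow> y \<in> S \<Longrightarrow> dist x y \<le> \<delta>"
  shows "diameter S \<le> \<delta>"
  using assms by (auto simp: diameter_def intro!: cSUP_least)

lemma hausdorff_delta_le:
  assumes "A \<subseteq> (\<Union>n. U n)" "\<And>n. bounded (U n)" "\<And>n. diameter (U n) \<le> \<delta>"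
  shows "hausdorff_delta s \<delta> A \<le> (\<Sum>n::nat. ennreal (diameter (U n) powr s))"
  unfolding hausdorff_delta_def using assms by (intro INF_lower) auto

lemma hausdorff_delta_greatest:
  assumes "\<And>U :: nat \<Rightarrow> _. A \<subseteq> (\<Union>n. U n) \<Longrightarrow> (\<And>n. bounded (U n)) \<Longrightarrow>
      (\<And>n. diameter (U n) \<le> \<delta>) \<Longrightarrow> m \<le> (\<Sum>n. ennreal (diameter (U n) powr s))"
  shows "m \<le> hausdorff_delta s \<delta> A"
  unfolding hausdorff_delta_def using assms by (intro INF_greatest) auto

lemma hausdorff_delta_lessE:
  assumes "hausdorff_delta s \<delta> A < c"
  obtains U :: "nat \<Rightarrow> _" where "A \<subseteq> (\<Union>n. U n)" "\<And>n. bounded (U n)" "\<And>n. diameter (U n) \<le> \<delta>"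
    "(\<Sum>n. ennreal (diameter (U n) powr s)) < c"
  using assms unfolding hausdorff_delta_def INF_less_iff by blast

lemma hausdorff_delta_mono: "A \<subseteq> B \<Longrightarrow> hausdorff_delta s \<delta> A \<le> hausdorff_delta s \<delta> B"
  by (intro hausdorff_delta_greatest hausdorff_delta_le) auto

lemma hausdorff_delta_antimono: "\<delta> \<le> \<delta>' \<Longrightarrow> hausdorff_delta s \<delta>' A \<le> hausdorff_delta s \<delta> A"
  by (intro hausdorff_delta_greatest hausdorff_delta_le) (auto intro: order_trans)

text \<open>A constant cover suffices because \<open>0 powr s\<close> is 0 for every
  \<open>s\<close>, even for \<open>s = 0\<close>.\<close>

lemma hausdorff_delta_singleton:
  assumes "0 \<le> \<delta>"
  shows "hausdorff_delta s \<delta> {x} = 0"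
  using hausdorff_delta_le[of "{x}" "\<lambda>_. {x}" \<delta> s] assms by simp

lemma hausdorff_delta_le_diameter:
  assumes "bounded A" "diameter A \<le> \<delta>"
  shows "hausdorff_delta s \<delta> A \<le> ennreal (diameter A powr s)"
proof -
  have "0 \<le> \<delta>"
    using diameter_ge_0[OF assms(1)] assms(2) by linarith
  then have "hausdorff_delta s \<delta> A \<le> (\<Sum>n::nat. ennreal (diameter (if n = 0 then A else {}) powr s))"
    using assms by (intro hausdorff_delta_le) auto
  also have "\<dots> = ennreal (diameter A powr s)"
    by (subst suminf_finite[of "{0}"]) auto
  finally show ?thesis .
qed

lemma hausdorff_delta_UN:
  fixes A :: "nat \<Rightarrow> 'a::metric_space set"
  shows "hausdorff_delta s \<delta> (\<Union>n. A n) \<le> (\<Sum>n. hausdorff_delta s \<delta> (A n))"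
proof (rule ennreal_le_epsilon)
  fix e :: real
  assume e: "0 < e" and fin: "(\<Sum>n. hausdorff_delta s \<delta> (A n)) < top"
  have "\<exists>U :: nat \<Rightarrow> 'a set. A n \<subseteq> (\<Union>i. U i) \<and> (\<forall>i. bounded (U i) \<and> diameter (U i) \<le> \<delta>) \<and>
      (\<Sum>i. ennreal (diameter (U i) powr s)) \<le> hausdorff_delta s \<delta> (A n) + e * (1/2)^Suc n" for n
  proof -
    \<comment> \<open>Strictness needs each term to be finite, which follows from
      \<open>fin\<close>.\<close>
    have "hausdorff_delta s \<delta> (A n) < hausdorff_delta s \<delta> (A n) + e * (1/2)^Suc n"
      using e fin by (auto simp: less_top dest!: ennreal_suminf_lessD)
    from hausdorff_delta_lessE[OF this] show ?thesis
      by (metis less_imp_le)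
  qed
  then obtain U :: "nat \<Rightarrow> nat \<Rightarrow> 'a set" where U: "\<And>n. A n \<subseteq> (\<Union>i. U n i)"
      "\<And>n i. bounded (U n i)" "\<And>n i. diameter (U n i) \<le> \<delta>"
      "\<And>n. (\<Sum>i. ennreal (diameter (U n i) powr s)) \<le> hausdorff_delta s \<delta> (A n) + e * (1/2)^Suc n"
    by metis
  define V where "V = (\<lambda>k. case_prod U (prod_decode k))"
  have "(\<Union>n. A n) \<subseteq> (\<Union>k. V k)"
  proof
    fix x assume "x \<in> (\<Union>n. A n)"
    then obtain n i where "x \<in> U n i" using U(1) by blast
    then have "x \<in> V (prod_encode (n, i))" by (simp add: V_def)
    then show "x \<in> (\<Union>k. V k)" by blast
  qed
  then have "hausdorff_delta s \<delta> (\<Union>n. A n) \<le> (\<Sum>k. ennreal (diameter (V k) powr s))"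
    using U(2,3) by (intro hausdorff_delta_le) (auto simp: V_def split: prod.split)
  also have "\<dots> = (\<Sum>k. (\<lambda>(n, i). ennreal (diameter (U n i) powr s)) (prod_decode k))"
    by (simp add: V_def case_prod_beta)
  also have "\<dots> = (\<Sum>n. \<Sum>i. ennreal (diameter (U n i) powr s))"
    by (rule suminf_ennreal_2dimen) simp
  also have "\<dots> \<le> (\<Sum>n. hausdorff_delta s \<delta> (A n) + e * (1/2) ^ Suc n)"
    by (intro suminf_le U(4)) auto
  also have "\<dots> = (\<Sum>n. hausdorff_delta s \<delta> (A n)) + (\<Sum>n. ennreal e * ennreal ((1/2) ^ Suc n))"
    using e by (subst suminf_add[symmetric])
      (auto simp del: ennreal_suminf_cmult simp add: ennreal_mult[symmetric])
  also have "\<dots> = (\<Sum>n. hausdorff_delta s \<delta> (A n)) + e"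
    unfolding ennreal_suminf_cmult
    by (subst suminf_ennreal_eq[OF zero_le_power power_half_series]) auto
  finally show "hausdorff_delta s \<delta> (\<Union>n. A n) \<le> (\<Sum>n. hausdorff_delta s \<delta> (A n)) + e" .
qed

lemma hausdorff_delta_empty:
  assumes "0 \<le> \<delta>" shows "hausdorff_delta s \<delta> {} = 0"
  using hausdorff_delta_mono[of "{}" "{undefined}" s \<delta>]
  by (simp add: hausdorff_delta_singleton[OF assms])

lemma hausdorff_delta_UN_finite:
  assumes "finite I" "0 \<le> \<delta>"
  shows "hausdorff_delta s \<delta> (\<Union>i\<in>I. A i) \<le> (\<Sum>i\<in>I. hausdorff_delta s \<delta> (A i))"
proof -
  obtain f n where f: "I = f ` {i::nat. i < n}" "inj_on f {i. i < n}"
    using finite_imp_nat_seg_image_inj_on[OF assms(1)] by auto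
  have "hausdorff_delta s \<delta> (\<Union>i\<in>I. A i) = hausdorff_delta s \<delta> (\<Union>k::nat. if k < n then A (f k) else {})"
    by (rule arg_cong[where f = "hausdorff_delta s \<delta>"]) (auto simp: f split: if_splits)
  also have "\<dots> \<le> (\<Sum>k. hausdorff_delta s \<delta> (if k < n then A (f k) else {}))"
    by (rule hausdorff_delta_UN)
  also have "\<dots> = (\<Sum>k\<in>{i. i < n}. hausdorff_delta s \<delta> (A (f k)))"
    by (subst suminf_finite[of "{i. i < n}"]) (auto simp: hausdorff_delta_empty assms)
  also have "\<dots> = (\<Sum>i\<in>I. hausdorff_delta s \<delta> (A i))"
    by (simp add: f sum.reindex)
  finally show ?thesis .
qed

lemma hausdorff_delta_image:
  fixes f :: "'a::metric_space \<Rightarrow> 'b::metric_space"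
  assumes "0 < c" "0 \<le> s" "\<And>x y. dist (f x) (f y) \<le> c * dist x y"
  shows "hausdorff_delta s (c * \<delta>) (f ` A) \<le> ennreal (c powr s) * hausdorff_delta s \<delta> A"
proof -
  \<comment> \<open>Division leaves the infimum over covers of \<open>A\<close> alone on the right,
    so that a single cover can be compared with its image.\<close>
  have "hausdorff_delta s (c * \<delta>) (f ` A) / ennreal (c powr s) \<le> hausdorff_delta s \<delta> A"
  proof (rule hausdorff_delta_greatest)
    fix U :: "nat \<Rightarrow> 'a set"
    assume U: "A \<subseteq> (\<Union>n. U n)" "\<And>n. bounded (U n)" "\<And>n. diameter (U n) \<le> \<delta>"
    have dist_le: "dist a b \<le> c * diameter (U n)" if "a \<in> f ` U n" "b \<in> f ` U n" for n a b
    proof -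
      obtain x y where "x \<in> U n" "y \<in> U n" "a = f x" "b = f y" using \<open>a \<in> f ` U n\<close> \<open>b \<in> f ` U n\<close> by blast
      then have "dist a b \<le> c * dist x y" "dist x y \<le> diameter (U n)"
        using assms(3) diameter_bounded_bound[OF U(2)] by auto
      then show ?thesis
        using assms(1) by (meson mult_left_mono less_imp_le order_trans)
    qed
    have diam: "diameter (f ` U n) \<le> c * diameter (U n)" for n
      using assms(1) diameter_ge_0[OF U(2)] dist_le by (intro diameter_le_dist) auto
    have bdd: "bounded (f ` U n)" for n
      using dist_le bounded_two_points by blast
    have le: "diameter (f ` U n) powr s \<le> c powr s * diameter (U n) powr s" for n
      using assms diam diameter_ge_0[OF bdd] diameter_ge_0[OF U(2)]
      by (subst powr_mult[symmetric]) (auto intro!: powr_mono2)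
    have "diameter (f ` U n) \<le> c * \<delta>" for n
      using diam[of n] mult_left_mono[OF U(3)[of n], of c] assms(1) by linarith
    moreover have "f ` A \<subseteq> (\<Union>n. f ` U n)"
      using U(1) by blast
    ultimately have "hausdorff_delta s (c * \<delta>) (f ` A) \<le> (\<Sum>n. ennreal (diameter (f ` U n) powr s))"
      using bdd by (intro hausdorff_delta_le)
    also have "\<dots> \<le> (\<Sum>n. ennreal (c powr s) * ennreal (diameter (U n) powr s))"
      by (intro suminf_le) (auto simp: ennreal_mult[symmetric] le intro!: ennreal_leI)
    finally show "hausdorff_delta s (c * \<delta>) (f ` A) / ennreal (c powr s) \<le> (\<Sum>n. ennreal (diameter (U n) powr s))"
      using assms(1) by (intro divide_le_posI_ennreal) auto
  qed
  then have "ennreal (c powr s) * (hausdorff_delta s (c * \<delta>) (f ` A) / ennreal (c powr s))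
      \<le> ennreal (c powr s) * hausdorff_delta s \<delta> A"
    by (rule mult_left_mono) simp
  then show ?thesis
    using assms(1) by (simp add: ennreal_times_divide mult.commute[of "ennreal (c powr s)"] ennreal_mult_divide_eq)
qed

section \<open>The Hausdorff outer measure\<close>

lemma hausdorff_delta_le_outer: "0 < \<delta> \<Longrightarrow> hausdorff_delta s \<delta> A \<le> hausdorff_outer s A"
  unfolding hausdorff_outer_def by (intro SUP_upper) auto

lemma hausdorff_outer_least: "(\<And>\<delta>. 0 < \<delta> \<Longrightarrow> hausdorff_delta s \<delta> A \<le> c) \<Longrightarrow> hausdorff_outer s A \<le> c"
  unfolding hausdorff_outer_def by (intro SUP_least) auto

lemma hausdorff_outer_mono: "A \<subseteq> B \<Longrightarrow> hausdorff_outer s A \<le> hausdorff_outer s B"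
  by (meson hausdorff_outer_least hausdorff_delta_le_outer hausdorff_delta_mono order_trans)

lemma hausdorff_outer_singleton: "hausdorff_outer s {x} = 0"
  using hausdorff_outer_least[of s "{x}" 0] hausdorff_delta_singleton[of _ s x]
  by (metis le_zero_eq less_imp_le order_refl)

lemma hausdorff_outer_empty: "hausdorff_outer s {} = 0"
  using hausdorff_outer_mono[of "{}" "{undefined}" s] hausdorff_outer_singleton by (metis empty_subsetI le_zero_eq)

lemma hausdorff_outer_UN:
  fixes A :: "nat \<Rightarrow> 'a::metric_space set"
  shows "hausdorff_outer s (\<Union>n. A n) \<le> (\<Sum>n. hausdorff_outer s (A n))"
proof (rule hausdorff_outer_least)
  fix \<delta> :: real assume "0 < \<delta>"
  then have "(\<Sum>n. hausdorff_delta s \<delta> (A n)) \<le> (\<Sum>n. hausdorff_outer s (A n))"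
    by (intro suminf_le hausdorff_delta_le_outer) auto
  with hausdorff_delta_UN show "hausdorff_delta s \<delta> (\<Union>n. A n) \<le> (\<Sum>n. hausdorff_outer s (A n))"
    by (rule order_trans)
qed

lemma hausdorff_outer_UN_finite:
  assumes "finite I"
  shows "hausdorff_outer s (\<Union>i\<in>I. A i) \<le> (\<Sum>i\<in>I. hausdorff_outer s (A i))"
proof (rule hausdorff_outer_least)
  fix \<delta> :: real assume "0 < \<delta>"
  then have "hausdorff_delta s \<delta> (\<Union>i\<in>I. A i) \<le> (\<Sum>i\<in>I. hausdorff_delta s \<delta> (A i))"
    by (intro hausdorff_delta_UN_finite assms) auto
  also have "\<dots> \<le> (\<Sum>i\<in>I. hausdorff_outer s (A i))"
    using \<open>0 < \<delta>\<close> by (intro sum_mono hausdorff_delta_le_outer)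
  finally show "hausdorff_delta s \<delta> (\<Union>i\<in>I. A i) \<le> (\<Sum>i\<in>I. hausdorff_outer s (A i))" .
qed

lemma hausdorff_outer_Un: "hausdorff_outer s (A \<union> B) \<le> hausdorff_outer s A + hausdorff_outer s B"
  using hausdorff_outer_UN_finite[of "UNIV :: bool set" s "\<lambda>b. if b then A else B"]
  by (simp add: UNIV_bool Un_commute add.commute)

lemma outer_measure_space_hausdorff_outer: "outer_measure_space (Pow \<Omega>) (hausdorff_outer s)"
  unfolding outer_measure_space_def positive_def increasing_def countably_subadditive_def
  by (auto simp: hausdorff_outer_empty intro: hausdorff_outer_mono hausdorff_outer_UN)

text \<open>A covering set of diameter at most \<open>\<delta>\<close> is too small to meet both
  \<open>A\<close> and \<open>B\<close>, so its weight is charged to only one of them.\<close>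

lemma hausdorff_delta_separated:
  fixes A B :: "'a::metric_space set"
  assumes "0 \<le> s" "\<delta> < d" "\<And>x y. x \<in> A \<Longrightarrow> y \<in> B \<Longrightarrow> d \<le> dist x y"
  shows "hausdorff_delta s \<delta> A + hausdorff_delta s \<delta> B \<le> hausdorff_delta s \<delta> (A \<union> B)"
proof (rule hausdorff_delta_greatest)
  fix U :: "nat \<Rightarrow> 'a set"
  assume U: "A \<union> B \<subseteq> (\<Union>n. U n)" "\<And>n. bounded (U n)" "\<And>n. diameter (U n) \<le> \<delta>"
  have diam: "diameter (U n \<inter> C) \<le> diameter (U n)" and bdd: "bounded (U n \<inter> C)" for n C
    using U(2) by (auto intro: diameter_subset)
  have disj: "U n \<inter> A = {} \<or> U n \<inter> B = {}" for n
  proof (rule ccontr)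
    assume "\<not> ?thesis"
    then obtain x y where xy: "x \<in> U n" "x \<in> A" "y \<in> U n" "y \<in> B" by blast
    then have "d \<le> diameter (U n)"
      using assms(3) diameter_bounded_bound[OF U(2)] by (meson order_trans)
    with U(3)[of n] assms(2) show False by linarith
  qed
  have "hausdorff_delta s \<delta> C \<le> (\<Sum>n. ennreal (diameter (U n \<inter> C) powr s))" if "C \<subseteq> A \<union> B" for C
    using U that by (intro hausdorff_delta_le bdd order_trans[OF diam]) auto
  then have "hausdorff_delta s \<delta> A + hausdorff_delta s \<delta> B
      \<le> (\<Sum>n. ennreal (diameter (U n \<inter> A) powr s)) + (\<Sum>n. ennreal (diameter (U n \<inter> B) powr s))"
    by (intro add_mono) auto
  also have "\<dots> = (\<Sum>n. ennreal (diameter (U n \<inter> A) powr s) + ennreal (diameter (U n \<inter> B) powr s))"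
    by (rule suminf_add) auto
  also have "\<dots> \<le> (\<Sum>n. ennreal (diameter (U n) powr s))"
  proof (intro suminf_le)
    fix n
    have "diameter (U n \<inter> C) powr s \<le> diameter (U n) powr s" for C
      using assms(1) diam diameter_ge_0[OF bdd] by (intro powr_mono2)
    then show "ennreal (diameter (U n \<inter> A) powr s) + ennreal (diameter (U n \<inter> B) powr s)
        \<le> ennreal (diameter (U n) powr s)"
      using disj[of n] by (auto intro!: ennreal_leI)
  qed auto
  finally show "hausdorff_delta s \<delta> A + hausdorff_delta s \<delta> B \<le> (\<Sum>n. ennreal (diameter (U n) powr s))" .
qed

lemma hausdorff_outer_separated:
  fixes A B :: "'a::metric_space set"
  assumes "0 \<le> s" "0 < d" "\<And>x y. x \<in> A \<Longrightarrow> y \<in> B \<Longrightarrow> d \<le> dist x y"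
  shows "hausdorff_outer s A + hausdorff_outer s B \<le> hausdorff_outer s (A \<union> B)"
proof -
  have "hausdorff_outer s A + hausdorff_outer s B
      = (SUP \<delta>\<in>{0<..}. hausdorff_delta s \<delta> A + hausdorff_delta s \<delta> B)"
    unfolding hausdorff_outer_def
  proof (rule SUP_add_directed_ennreal[symmetric])
    \<comment> \<open>The premeasures grow as the scale shrinks, so the smaller of two scales serves
      both sets.\<close>
    fix i j :: real assume "i \<in> {0<..}" "j \<in> {0<..}"
    then show "\<exists>k\<in>{0<..}. hausdorff_delta s i A + hausdorff_delta s j B
        \<le> hausdorff_delta s k A + hausdorff_delta s k B"
      by (intro bexI[of _ "min i j"] add_mono hausdorff_delta_antimono) auto
  qed
  also have "\<dots> \<le> hausdorff_outer s (A \<union> B)"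
  proof (rule SUP_least)
    fix \<delta> :: real assume "\<delta> \<in> {0<..}"
    then have "hausdorff_delta s \<delta> A + hausdorff_delta s \<delta> B
        \<le> hausdorff_delta s (min \<delta> (d/2)) A + hausdorff_delta s (min \<delta> (d/2)) B"
      by (intro add_mono hausdorff_delta_antimono) auto
    also have "\<dots> \<le> hausdorff_delta s (min \<delta> (d/2)) (A \<union> B)"
      using assms by (intro hausdorff_delta_separated[of s _ d]) auto
    also have "\<dots> \<le> hausdorff_outer s (A \<union> B)"
      using assms \<open>\<delta> \<in> {0<..}\<close> by (intro hausdorff_delta_le_outer) auto
    finally show "hausdorff_delta s \<delta> A + hausdorff_delta s \<delta> B \<le> hausdorff_outer s (A \<union> B)" .
  qed
  finally show ?thesis .
qed

text \<open>Caratheodory's criterion. The part of \<open>S\<close> outside \<open>C\<close> is exhausted by the sets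
  \<open>E n\<close> of points at distance at least \<open>1/(n+1)\<close> from \<open>C\<close>; the annuli \<open>D n\<close> with indices of equal parity
  are pairwise separated, so their measures have a finite sum.\<close>

lemma hausdorff_outer_closed_split:
  fixes C S :: "'a::metric_space set"
  assumes s: "0 \<le> s" and "closed C"
  shows "hausdorff_outer s (S \<inter> C) + hausdorff_outer s (S - C) \<le> hausdorff_outer s S"
\<comment> \<open>\<open>infdist\<close> to the empty set is 0 by convention, so an empty
  \<open>C\<close> is treated apart. With infinite measure of \<open>S\<close> there is nothing to
  show.\<close>
proof (cases "C = {} \<or> hausdorff_outer s S = top")
  case True
  then show ?thesis
    by (auto simp: hausdorff_outer_empty)
next
  case False
  define r where "r n = 1 / real (Suc n)" for n
  have r_pos: "0 < r n" for n by (simp add: r_def)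
  have r_less: "r n < r m" if "m < n" for m n
    using that by (simp add: r_def field_simps)
  have r_le: "r n \<le> r m" if "m \<le> n" for m n
    using that by (simp add: r_def field_simps)
  define E where "E n = {x \<in> S. r n \<le> infdist x C}" for n
  define D where "D n = {x \<in> S. r (Suc n) \<le> infdist x C \<and> infdist x C < r n}" for n
  let ?f = "\<lambda>n. hausdorff_outer s (D n)"
  have E_le: "hausdorff_outer s (S \<inter> C) + hausdorff_outer s (E n) \<le> hausdorff_outer s S" for n
  proof -
    have "r n \<le> dist x y" if "x \<in> S \<inter> C" "y \<in> E n" for x y
      using that infdist_le[of x C y] by (auto simp: E_def dist_commute)
    then have "hausdorff_outer s (S \<inter> C) + hausdorff_outer s (E n) \<le> hausdorff_outer s (S \<inter> C \<union> E n)"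
      using s r_pos by (intro hausdorff_outer_separated)
    also have "\<dots> \<le> hausdorff_outer s S"
      by (intro hausdorff_outer_mono) (auto simp: E_def)
    finally show ?thesis .
  qed
  have diff_sub: "S - C \<subseteq> E n \<union> (\<Union>k. D (k + n))" for n
  proof
    fix x assume x: "x \<in> S - C"
    then have "0 < infdist x C"
      using assms(2) False in_closed_iff_infdist_zero[of C x] infdist_nonneg[of x C] by auto
    then obtain m where "r m < infdist x C"
      unfolding r_def by (rule nat_approx_posE)
    then have ex: "\<exists>m. r m \<le> infdist x C" by (auto intro: less_imp_le)
    \<comment> \<open>For \<open>m > n\<close> minimality puts \<open>x\<close> into the annulus of
      index \<open>m - 1\<close>, written below as \<open>(m - Suc n) + n\<close>.\<close>
    define m where "m = (LEAST m. r m \<le> infdist x C)"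
    have m: "r m \<le> infdist x C" "\<And>k. k < m \<Longrightarrow> infdist x C < r k"
      using LeastI_ex[OF ex] not_less_Least by (fastforce simp: m_def)+
    show "x \<in> E n \<union> (\<Union>k. D (k + n))"
    proof (cases "m \<le> n")
      case True
      then show ?thesis using x m(1) r_le[of m n] by (auto simp: E_def)
    next
      case False
      then have "x \<in> D ((m - Suc n) + n)"
        using x m by (auto simp: D_def Suc_diff_Suc)
      then show ?thesis by blast
    qed
  qed
  have parity: "(\<Sum>k<N. ?f (2 * k + p)) \<le> hausdorff_outer s (\<Union>k<N. D (2 * k + p))" for N p
  proof (induction N)
    case (Suc N)
    \<comment> \<open>The skipped annulus of index \<open>2 * N + p - 1\<close> separates the new
      annulus from the earlier ones. For \<open>N = 0\<close> there are no earlier ones, and this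
      case is settled separately below.\<close>
    have "r (2 * N + p - 1) - r (2 * N + p) \<le> dist x y"
      if x: "x \<in> (\<Union>k<N. D (2 * k + p))" and y: "y \<in> D (2 * N + p)" for x y
    proof -
      obtain k where k: "k < N" "x \<in> D (2 * k + p)" using x by auto
      then have "r (2 * N + p - 1) \<le> infdist x C"
        by (intro order_trans[OF r_le[of "Suc (2 * k + p)" "2 * N + p - 1"]]) (auto simp: D_def)
      moreover have "infdist y C < r (2 * N + p)" using y by (simp add: D_def)
      ultimately show ?thesis
        using infdist_triangle[of x C y] by linarith
    qed
    then have "hausdorff_outer s (\<Union>k<N. D (2 * k + p)) + ?f (2 * N + p)
        \<le> hausdorff_outer s ((\<Union>k<N. D (2 * k + p)) \<union> D (2 * N + p))" if "0 < N"
      using s that r_less[of "2 * N + p - 1" "2 * N + p"] by (intro hausdorff_outer_separated) auto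
    then have step: "hausdorff_outer s (\<Union>k<N. D (2 * k + p)) + ?f (2 * N + p)
        \<le> hausdorff_outer s ((\<Union>k<N. D (2 * k + p)) \<union> D (2 * N + p))"
      by (cases "N = 0") (auto simp: hausdorff_outer_empty)
    have "(\<Sum>k<Suc N. ?f (2 * k + p)) \<le> hausdorff_outer s (\<Union>k<N. D (2 * k + p)) + ?f (2 * N + p)"
      unfolding sum.lessThan_Suc by (intro add_right_mono Suc.IH)
    also note step
    also have "(\<Union>k<N. D (2 * k + p)) \<union> D (2 * N + p) = (\<Union>k<Suc N. D (2 * k + p))"
      by (auto simp: lessThan_Suc)
    finally show ?case .
  qed (simp add: hausdorff_outer_empty)
  have parity_le: "(\<Sum>k<N. ?f (2 * k + p)) \<le> hausdorff_outer s S" for N p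
    by (rule order_trans[OF parity hausdorff_outer_mono]) (auto simp: D_def)
  have sum_le: "(\<Sum>k<N. ?f k) \<le> hausdorff_outer s S + hausdorff_outer s S" for N
  proof -
    have "(\<Sum>k<N. ?f k) \<le> (\<Sum>k<2 * N. ?f k)"
      by (intro sum_mono2) auto
    also have "\<dots> = (\<Sum>k<N. ?f (2 * k + 0)) + (\<Sum>k<N. ?f (2 * k + 1))"
      by (induction N) (simp_all add: ac_simps)
    also have "\<dots> \<le> hausdorff_outer s S + hausdorff_outer s S"
      by (intro add_mono parity_le)
    finally show ?thesis .
  qed
  have "(\<Sum>k. ?f k) \<le> hausdorff_outer s S + hausdorff_outer s S"
    by (intro suminf_le_const sum_le) auto
  then have fin: "(\<Sum>k. ?f k) \<noteq> top"
    using False by (auto simp: top_unique)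
  let ?L = "hausdorff_outer s (S \<inter> C) + hausdorff_outer s (S - C)"
  \<comment> \<open>With the partial sum added on both sides, the tail on the right completes to the
    whole series; its finite value is cancelled at the end.\<close>
  have "(\<Sum>k<n. ?f k) + ?L \<le> (\<Sum>k. ?f k) + hausdorff_outer s S" for n
  proof -
    have "hausdorff_outer s (S - C) \<le> hausdorff_outer s (E n) + (\<Sum>k. ?f (k + n))"
      by (rule order_trans[OF hausdorff_outer_mono[OF diff_sub[of n]]
            order_trans[OF hausdorff_outer_Un add_left_mono[OF hausdorff_outer_UN]]])
    then have "?L \<le> hausdorff_outer s (S \<inter> C) + (hausdorff_outer s (E n) + (\<Sum>k. ?f (k + n)))"
      by (rule add_left_mono)
    also have "\<dots> \<le> hausdorff_outer s S + (\<Sum>k. ?f (k + n))"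
      unfolding add.assoc[symmetric] by (intro add_right_mono E_le)
    finally have "(\<Sum>k<n. ?f k) + ?L \<le> (\<Sum>k<n. ?f k) + (hausdorff_outer s S + (\<Sum>k. ?f (k + n)))"
      by (rule add_left_mono)
    also have "\<dots> = (\<Sum>k. ?f k) + hausdorff_outer s S"
      by (subst suminf_offset[of ?f n]) (simp_all add: ac_simps)
    finally show ?thesis .
  qed
  then have "(\<Sum>k. ?f k) + ?L \<le> (\<Sum>k. ?f k) + hausdorff_outer s S"
    by (rule ennreal_suminf_bound_add)
  then show ?thesis
    using fin by (simp add: ennreal_add_left_cancel_le)
qed

text \<open>Caratheodory measurable subsets of \<open>K\<close> form a sigma-algebra, so relatively
  open sets suffice; for these the nontrivial inequality is
  \<open>hausdorff_outer_closed_split\<close> applied to the closed complement.\<close>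

lemma borel_subset_lambda_system_hausdorff_outer:
  assumes "0 \<le> s" "K \<in> sets borel"
  shows "sets (restrict_space borel K) \<subseteq> lambda_system K (Pow K) (hausdorff_outer s)"
proof -
  interpret Pow: sigma_algebra K "Pow K" by (rule sigma_algebra_Pow)
  interpret L: sigma_algebra K "lambda_system K (Pow K) (hausdorff_outer s)"
    using Pow.caratheodory_lemma[OF outer_measure_space_hausdorff_outer]
    by (simp add: measure_space_def)
  have "K \<inter> U \<in> lambda_system K (Pow K) (hausdorff_outer s)" if "open U" for U
    unfolding Pow.lambda_system_eq
  proof (safe intro!: antisym)
    fix S assume S: "S \<subseteq> K"
    have eq: "S \<inter> (K \<inter> U) = S - (- U)" "S - K \<inter> U = S \<inter> (- U)" using S by auto
    show "hausdorff_outer s (S \<inter> (K \<inter> U)) + hausdorff_outer s (S - K \<inter> U) \<le> hausdorff_outer s S"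
      using hausdorff_outer_closed_split[OF assms(1), of "- U" S] \<open>open U\<close>
      unfolding eq by (simp add: add.commute closed_def)
    show "hausdorff_outer s S \<le> hausdorff_outer s (S \<inter> (K \<inter> U)) + hausdorff_outer s (S - K \<inter> U)"
      by (rule order_trans[OF hausdorff_outer_mono hausdorff_outer_Un]) auto
  qed
  then have "sigma_sets K ((\<inter>) K ` Collect open) \<subseteq> lambda_system K (Pow K) (hausdorff_outer s)"
    by (intro L.sigma_sets_subset) auto
  moreover have "sets (restrict_space borel K) = sigma_sets K ((\<inter>) K ` Collect open)"
    using assms(2) by (simp add: sets_restrict_space borel_def sigma_sets_Int)
  ultimately show ?thesis by simp
qed

text \<open>\<open>measure_of\<close> assigns 0 to every set unless its set function is a measure,
  so countable additivity on the relative Borel sets must come before any value can be read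
  off.\<close>

lemma
  fixes K :: "'a::metric_space set"
  assumes "0 \<le> s" "K \<in> sets borel"
  shows space_hausdorff_measure_on: "space (hausdorff_measure_on s K) = K"
    and sets_hausdorff_measure_on: "sets (restrict_space borel K) \<subseteq> sets (hausdorff_measure_on s K)"
    and complete_hausdorff_measure_on: "complete_measure (hausdorff_measure_on s K)"
    and emeasure_hausdorff_measure_on:
      "A \<in> sets (restrict_space borel K) \<Longrightarrow> emeasure (hausdorff_measure_on s K) A = hausdorff_outer s A"
proof -
  let ?B = "sets (restrict_space borel K)"
  let ?M = "measure_of K ?B (hausdorff_outer s)"
  have sub: "?B \<subseteq> Pow K"
    using sets.space_closed[of "restrict_space borel K"] by (simp add: space_restrict_space)
  have sa: "sigma_algebra K ?B"
    using sets.sigma_algebra_axioms[of "restrict_space borel K"] by (simp add: space_restrict_space)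
  have sets: "sets ?M = ?B"
    using sub sa by (simp add: sigma_algebra.sigma_sets_eq)
  show "space (hausdorff_measure_on s K) = K"
    using sub by (simp add: hausdorff_measure_on_def space_measure_of)
  show "?B \<subseteq> sets (hausdorff_measure_on s K)"
    using sets by (auto simp: hausdorff_measure_on_def)
  show "complete_measure (hausdorff_measure_on s K)"
    unfolding hausdorff_measure_on_def by (rule completion.complete_measure_axioms)
  have "measure_space K (lambda_system K (Pow K) (hausdorff_outer s)) (hausdorff_outer s)"
    by (intro sigma_algebra.caratheodory_lemma sigma_algebra_Pow outer_measure_space_hausdorff_outer)
  then have "countably_additive ?B (hausdorff_outer s)" "positive ?B (hausdorff_outer s)"
    using borel_subset_lambda_system_hausdorff_outer[OF assms]
    by (auto simp: measure_space_def countably_additive_def positive_def)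
  then have "emeasure ?M A = hausdorff_outer s A" if "A \<in> ?B" for A
    using that sub sets by (intro emeasure_measure_of) auto
  then show "A \<in> ?B \<Longrightarrow> emeasure (hausdorff_measure_on s K) A = hausdorff_outer s A"
    using sets by (simp add: hausdorff_measure_on_def)
qed

section \<open>The Koch curve and its parametrization\<close>

text \<open>Indexing the maps lets \<open>i\<close> act as the leading base-4 digit of the
  parameter.\<close>

definition koch_map :: "nat \<Rightarrow> complex \<Rightarrow> complex" where
  "koch_map i z = (if i = 0 then z / 3
     else if i = 1 then 1/3 + cis (pi/3) * z / 3
     else if i = 2 then cis (pi/3) / 3 + 1/3 + cis (-pi/3) * z / 3
     else 2/3 + z / 3)"

lemma koch_maps_eq: "koch_maps = koch_map ` {..<4}"
proof -
  have "{..<4::nat} = {0, 1, 2, 3}" by auto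
  then show ?thesis
    by (simp add: koch_maps_def koch_map_def[abs_def])
qed

lemma dist_koch_map: "dist (koch_map i x) (koch_map i y) = dist x y / 3"
proof -
  have "dist (a + c * x / 3) (a + c * y / 3) = dist x y / 3" if "norm c = 1" for a c :: complex
  proof -
    have "a + c * x / 3 - (a + c * y / 3) = c * (x - y) / 3" by (simp add: field_simps)
    then show ?thesis using that unfolding dist_norm by (simp only: norm_mult norm_divide) simp
  qed
  from this[of 1 0] this[of 1 "2/3"] this[of "cis _"] show ?thesis
    unfolding koch_map_def by simp
qed

text \<open>In the coordinates \<open>Re z\<close> and \<open>sqrt 3 * Im z\<close> the maps are
  affine with rational coefficients, which leaves the geometric estimates below to
  \<open>linarith\<close>.\<close>

lemma
  shows Re_koch_map:
    "Re (koch_map 0 z) = Re z / 3"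
    "Re (koch_map 1 z) = 1/3 + Re z / 6 - sqrt 3 * Im z / 6"
    "Re (koch_map 2 z) = 1/2 + Re z / 6 + sqrt 3 * Im z / 6"
    "Re (koch_map 3 z) = 2/3 + Re z / 3"
  and Im_koch_map:
    "sqrt 3 * Im (koch_map 0 z) = sqrt 3 * Im z / 3"
    "sqrt 3 * Im (koch_map 1 z) = Re z / 2 + sqrt 3 * Im z / 6"
    "sqrt 3 * Im (koch_map 2 z) = 1/2 - Re z / 2 + sqrt 3 * Im z / 6"
    "sqrt 3 * Im (koch_map 3 z) = sqrt 3 * Im z / 3"
  by (simp_all add: koch_map_def cos_60 sin_60 field_simps flip: minus_divide_left)

lemma koch_map_0_0: "koch_map 0 0 = 0" and koch_map_3_1: "koch_map 3 1 = 1"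
  by (simp_all add: koch_map_def)

lemma koch_map_junction:
  assumes "i < 3"
  shows "koch_map (Suc i) 0 = koch_map i 1"
proof -
  have "i = 0 \<or> i = 1 \<or> i = 2" using assms by auto
  then show ?thesis
    by (auto simp: koch_map_def complex_eq_iff cos_60 sin_60 simp flip: minus_divide_left)
qed

text \<open>The convex hull of the Koch curve: the triangle with vertices \<open>0\<close>, \<open>1\<close> and
  \<open>1/2 + i sqrt 3 / 6\<close>. Scaling the imaginary part by \<open>sqrt 3\<close> makes all coordinates rational.\<close>

definition koch_triangle :: "complex set" where
  "koch_triangle = {z. 0 \<le> sqrt 3 * Im z \<and> sqrt 3 * Im z \<le> Re z \<and> sqrt 3 * Im z \<le> 1 - Re z}"

lemma less_4_cases: "i < (4::nat) \<Longrightarrow> i = 0 \<or> i = 1 \<or> i = 2 \<or> i = 3"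
  by auto

lemma koch_map_triangle:
  assumes "i < 4" "z \<in> koch_triangle"
  shows "koch_map i z \<in> koch_triangle"
  using less_4_cases[OF assms(1)] assms(2) unfolding koch_triangle_def mem_Collect_eq
  by (elim disjE conjE; simp only: Re_koch_map Im_koch_map; intro conjI; linarith)

lemma Im_triangle:
  assumes "z \<in> koch_triangle"
  shows "0 \<le> Im z" "Im z \<le> Re z" "Im z \<le> 1 - Re z"
proof -
  have "0 \<le> Im z" using assms by (simp add: koch_triangle_def zero_le_mult_iff)
  moreover from this have "1 * Im z \<le> sqrt 3 * Im z" by (intro mult_right_mono) auto
  ultimately show "0 \<le> Im z" "Im z \<le> Re z" "Im z \<le> 1 - Re z"
    using assms by (auto simp: koch_triangle_def)
qed

text \<open>The triangle is flat at its base vertices. This bound and its mirror image at 1 turn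
  gaps between real parts into bounds on distances to an endpoint.\<close>

lemma norm_triangle: "z \<in> koch_triangle \<Longrightarrow> norm z \<le> 2 * Re z"
  using cmod_le[of z] Im_triangle[of z] by linarith

lemma norm_1_minus_triangle: "z \<in> koch_triangle \<Longrightarrow> norm (1 - z) \<le> 2 * (1 - Re z)"
  using cmod_le[of "1 - z"] Im_triangle[of z] by auto

lemma koch_map_Re_bounds:
  assumes "z \<in> koch_triangle"
  shows "i < 4 \<Longrightarrow> 0 < i \<Longrightarrow> 1/3 \<le> Re (koch_map i z)" "i < 3 \<Longrightarrow> Re (koch_map i z) \<le> 2/3"
proof -
  show "1/3 \<le> Re (koch_map i z)" if "i < 4" "0 < i"
    using less_4_cases[OF that(1)] that(2) assms unfolding koch_triangle_def mem_Collect_eq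
    by (elim disjE conjE; simp only: Re_koch_map; linarith)
  have *: "i = 0 \<or> i = 1 \<or> i = 2" if "i < 3" using that by auto
  show "Re (koch_map i z) \<le> 2/3" if "i < 3"
    using *[OF that] assms unfolding koch_triangle_def mem_Collect_eq
    by (elim disjE conjE; simp only: Re_koch_map; linarith)
qed

text \<open>The real parts of the four pieces lie in [0,1/3], [1/3,1/2], [1/2,2/3] and [2/3,1].
  Skipping a piece leaves at least the length 1/6 of a middle interval.\<close>

lemma koch_map_nonadjacent:
  assumes "z \<in> koch_triangle" "w \<in> koch_triangle" "Suc i < j" "j < 4"
  shows "1/6 \<le> Re (koch_map j w) - Re (koch_map i z)"
proof -
  have "(i = 0 \<and> j = 2) \<or> (i = 0 \<and> j = 3) \<or> (i = 1 \<and> j = 3)"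
    using assms(3,4) by auto
  then show ?thesis
    using assms(1,2) unfolding koch_triangle_def mem_Collect_eq
    by (elim disjE conjE; simp only: Re_koch_map; linarith)
qed

text \<open>The real part may miss one side of a junction: a side of the triangle becomes vertical
  in piece 1 at real part 1/3 and in piece 2 at real part 2/3. It always sees the other side, hence
  the minimum.\<close>

lemma koch_map_adjacent:
  assumes "z \<in> koch_triangle" "w \<in> koch_triangle" "i < 3"
  shows "min (1/6 - Re z / 6) (Re w / 6) \<le> Re (koch_map (Suc i) w) - Re (koch_map i z)"
proof -
  have tri: "0 \<le> sqrt 3 * Im z" "sqrt 3 * Im z \<le> Re z" "sqrt 3 * Im z \<le> 1 - Re z"
    "0 \<le> sqrt 3 * Im w" "sqrt 3 * Im w \<le> Re w" "sqrt 3 * Im w \<le> 1 - Re w"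
    using assms(1,2) by (auto simp: koch_triangle_def)
  have "1/6 - Re z / 6 \<le> Re (koch_map 1 w) - Re (koch_map 0 z)"
    "Re w / 6 \<le> Re (koch_map 2 w) - Re (koch_map 1 z)"
    "Re w / 6 \<le> Re (koch_map 3 w) - Re (koch_map 2 z)"
    unfolding Re_koch_map using tri by linarith+
  moreover have "(i = 0 \<and> Suc i = 1) \<or> (i = 1 \<and> Suc i = 2) \<or> (i = 2 \<and> Suc i = 3)"
    using assms(3) by auto
  ultimately show ?thesis
    by (elim disjE conjE) (simp_all only: min.coboundedI1 min.coboundedI2)
qed

abbreviation koch_dim :: real where "koch_dim \<equiv> ln 4 / ln 3"

lemma powr_koch_dim: "(3::real) powr koch_dim = 4" "(9::real) powr koch_dim = 16"
proof -
  show *: "(3::real) powr koch_dim = 4" by (simp add: powr_def)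
  have "(9::real) powr koch_dim = (3 * 3) powr koch_dim" by simp
  also have "\<dots> = 16" by (subst powr_mult) (simp_all add: * del: mult_numeral_1 numeral_times_numeral)
  finally show "(9::real) powr koch_dim = 16" .
qed

lemma koch_dim_gt_1: "1 < koch_dim"
  by simp

lemma powr_koch_dim_scale:
  assumes "0 \<le> d"
  shows "(d / 3) powr koch_dim = d powr koch_dim / 4"
  using assms by (simp add: powr_divide powr_koch_dim)

text \<open>The graph of the Koch parametrization over the \<open>4\<close>-adic points of \<open>[0,1]\<close>.\<close>

inductive_set koch_graph :: "(complex \<times> real) set" where
  zero: "(0, 0) \<in> koch_graph"
| one: "(1, 1) \<in> koch_graph"
| step: "(z, t) \<in> koch_graph \<Longrightarrow> i < 4 \<Longrightarrow> (koch_map i z, (real i + t) / 4) \<in> koch_graph"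

lemma koch_points_eq: "koch_points = fst ` koch_graph"
proof (intro equalityI subsetI)
  fix z assume "z \<in> koch_points"
  then show "z \<in> fst ` koch_graph"
  proof induction
    case (step z f)
    then obtain t i where "(z, t) \<in> koch_graph" "i < 4" "f = koch_map i"
      by (auto simp: koch_maps_eq)
    then show ?case
      using koch_graph.step by force
  qed (force intro: koch_graph.intros)+
next
  fix z assume "z \<in> fst ` koch_graph"
  then obtain t where "(z, t) \<in> koch_graph" by auto
  then show "z \<in> koch_points"
  proof induction
    case (step z t i)
    then show ?case using koch_points.step[of z "koch_map i"] by (simp add: koch_maps_eq)
  qed (auto intro: koch_points.intros)
qed

lemma koch_graph_bounds:
  assumes "(z, t) \<in> koch_graph"
  shows "z \<in> koch_triangle" "0 \<le> t" "t \<le> 1"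
proof -
  have "z \<in> koch_triangle \<and> 0 \<le> t \<and> t \<le> 1"
    using assms
  proof induction
    case (step z t i)
    then have "real i \<le> 3" by simp
    with step show ?case by (auto intro: koch_map_triangle)
  qed (auto simp: koch_triangle_def)
  then show "z \<in> koch_triangle" "0 \<le> t" "t \<le> 1" by auto
qed

section \<open>The Hoelder estimate over the 4-adic points\<close>

lemma powr_koch_dim_ge:
  assumes "1 / 3 \<le> d"
  shows "1 / 4 \<le> d powr koch_dim"
  using powr_mono2[of koch_dim "1/3" d] powr_koch_dim_scale[of 1] assms by simp

text \<open>In the piece that contains the endpoint both sides shrink by the factor 4. In the other
  pieces the distance to the endpoint is at least 1/3, and
  \<open>4 * (1/3) powr koch_dim = 1\<close> already bounds any parameter difference.\<close>

lemma koch_graph_endpoints: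
  assumes "(z, t) \<in> koch_graph"
  shows "t \<le> 4 * norm z powr koch_dim" "1 - t \<le> 4 * norm (1 - z) powr koch_dim"
proof -
  have "t \<le> 4 * norm z powr koch_dim \<and> 1 - t \<le> 4 * norm (1 - z) powr koch_dim"
    using assms
  proof induction
    case (step z t i)
    note b = koch_graph_bounds[OF step.hyps(1)]
    have "real i \<le> 3" using step.hyps by simp
    have "(real i + t) / 4 \<le> 4 * norm (koch_map i z) powr koch_dim"
    proof (cases "i = 0")
      case True
      have "norm (koch_map 0 z) = norm z / 3"
        using dist_koch_map[of 0 z 0] by (simp add: koch_map_0_0)
      from powr_koch_dim_scale[OF norm_ge_zero, of z, folded this]
      show ?thesis using step.IH True by simp
    next
      case False
      then have "1 / 3 \<le> norm (koch_map i z)"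
        using koch_map_Re_bounds(1)[OF b(1) step.hyps(2)] complex_Re_le_cmod[of "koch_map i z"] by linarith
      then show ?thesis
        using powr_koch_dim_ge[of "norm (koch_map i z)"] b \<open>real i \<le> 3\<close> by simp
    qed
    moreover have "1 - (real i + t) / 4 \<le> 4 * norm (1 - koch_map i z) powr koch_dim"
    proof (cases "i = 3")
      case True
      have "norm (1 - koch_map 3 z) = norm (1 - z) / 3"
        using dist_koch_map[of 3 1 z] by (simp add: koch_map_3_1 dist_norm)
      from powr_koch_dim_scale[OF norm_ge_zero, of "1 - z", folded this]
      show ?thesis using step.IH True by (simp add: field_simps)
    next
      case False
      then have "1 / 3 \<le> norm (1 - koch_map i z)"
        using koch_map_Re_bounds(2)[OF b(1), of i] step.hyps(2) complex_Re_le_cmod[of "1 - koch_map i z"] by simp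
      then show ?thesis
        using powr_koch_dim_ge[of "norm (1 - koch_map i z)"] b by (simp add: field_simps)
    qed
    ultimately show ?case ..
  qed auto
  then show "t \<le> 4 * norm z powr koch_dim" "1 - t \<le> 4 * norm (1 - z) powr koch_dim" by auto
qed

text \<open>Serves the base cases of \<open>koch_graph_holder\<close>, which carry the constant
  128.\<close>

lemma koch_graph_endpoints_weak:
  assumes "(z, t) \<in> koch_graph"
  shows "t \<le> 128 * norm z powr koch_dim" "1 - t \<le> 128 * norm (1 - z) powr koch_dim"
proof -
  have "4 * x powr koch_dim \<le> 128 * x powr koch_dim" for x :: real
    by (intro mult_right_mono) auto
  from order_trans[OF koch_graph_endpoints(1)[OF assms] this]
    order_trans[OF koch_graph_endpoints(2)[OF assms] this]
  show "t \<le> 128 * norm z powr koch_dim" "1 - t \<le> 128 * norm (1 - z) powr koch_dim" .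
qed

text \<open>Pieces that are not neighbours are at least 1/6 apart. Neighbours share the vertex
  \<open>p\<close>, which splits the parameter gap into \<open>(1 - t) / 4\<close> and
  \<open>u / 4\<close>, each controlled by an endpoint estimate.\<close>

lemma koch_graph_holder_pieces:
  assumes G: "(z, t) \<in> koch_graph" "(w, u) \<in> koch_graph" and ij: "i < j" "j < 4"
  shows "\<bar>(real i + t) / 4 - (real j + u) / 4\<bar> \<le> 128 * dist (koch_map i z) (koch_map j w) powr koch_dim"
proof -
  note z = koch_graph_bounds[OF G(1)] and w = koch_graph_bounds[OF G(2)]
  define d where "d = dist (koch_map i z) (koch_map j w)"
  have Re: "Re (koch_map j w) - Re (koch_map i z) \<le> d"
    using complex_Re_le_cmod[of "koch_map j w - koch_map i z"] by (simp add: d_def dist_norm norm_minus_commute)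
  have scale: "(9 * x) powr koch_dim = 16 * x powr koch_dim" if "0 \<le> x" for x
    using that by (simp add: powr_mult powr_koch_dim)
  show ?thesis
  proof (cases "j = Suc i")
    case False
    then have "1 / 6 \<le> d"
      using koch_map_nonadjacent[OF z(1) w(1), of i j] ij Re by auto
    then have "1 / 3 \<le> 9 * d" by simp
    then have "1 / 4 \<le> 16 * d powr koch_dim"
      using powr_koch_dim_ge[of "9 * d"] \<open>1 / 6 \<le> d\<close> scale[of d] by simp
    moreover have "\<bar>(real i + t) / 4 - (real j + u) / 4\<bar> \<le> 1"
      using z w ij by (auto simp: abs_le_iff field_simps)
    ultimately show ?thesis by (simp add: d_def)
  next
    case True
    define p where "p = koch_map i 1"
    have i: "i < 3" using ij True by simp
    have p: "p = koch_map j 0" using koch_map_junction[OF i] True by (simp add: p_def)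
    have d1: "dist (koch_map i z) p = norm (1 - z) / 3"
      unfolding p_def dist_koch_map by (simp add: dist_norm norm_minus_commute)
    have d2: "dist (koch_map j w) p = norm w / 3"
      by (simp add: p dist_koch_map)
    have tri: "dist (koch_map i z) p \<le> dist (koch_map j w) p + d" "dist (koch_map j w) p \<le> dist (koch_map i z) p + d"
      unfolding d_def by (metis dist_triangle dist_commute add.commute)+
    have "1/6 - Re z / 6 \<le> d \<or> Re w / 6 \<le> d"
      using order_trans[OF koch_map_adjacent[OF z(1) w(1) i] Re[unfolded True]] by (simp add: min_le_iff_disj)
    then have "norm (1 - z) / 3 \<le> 4 * d \<or> norm w / 3 \<le> 4 * d"
      using norm_triangle[OF w(1)] norm_1_minus_triangle[OF z(1)] by auto
    \<comment> \<open>The triangle inequality yields 5 * d; the factor 9 is taken because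
      \<open>9 powr koch_dim\<close> is the integer 16.\<close>
    then have le: "norm (1 - z) / 3 \<le> 9 * d" "norm w / 3 \<le> 9 * d"
      using tri d1 d2 by (auto simp: d_def)
    have "(norm (1 - z) / 3) powr koch_dim \<le> (9 * d) powr koch_dim" "(norm w / 3) powr koch_dim \<le> (9 * d) powr koch_dim"
      using le by (intro powr_mono2; simp)+
    then have "norm (1 - z) powr koch_dim / 4 \<le> 16 * d powr koch_dim" "norm w powr koch_dim / 4 \<le> 16 * d powr koch_dim"
      by (simp_all add: powr_koch_dim_scale scale d_def)
    \<comment> \<open>Each norm to the power \<open>koch_dim\<close> is at most 64 times that of
      \<open>d\<close>; the endpoint constant 4 and the two summands give 512. The final division by
      4 leaves 128.\<close>
    then have "(1 - t) + u \<le> 512 * d powr koch_dim"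
      using koch_graph_endpoints(2)[OF G(1)] koch_graph_endpoints(1)[OF G(2)] by linarith
    then show ?thesis
      using z w True by (simp add: d_def abs_le_iff field_simps)
  qed
qed

text \<open>For two points in the same piece both sides of the inequality are 1/4 of those for their
  preimages, so the induction keeps its constant.\<close>

lemma koch_graph_holder:
  assumes "(z, t) \<in> koch_graph" "(w, u) \<in> koch_graph"
  shows "\<bar>t - u\<bar> \<le> 128 * dist z w powr koch_dim"
  using assms
proof (induction arbitrary: w u)
  case zero
  then show ?case
    using koch_graph_endpoints_weak(1)[OF zero] koch_graph_bounds[OF zero] by (simp add: dist_norm norm_minus_commute)
next
  case one
  then show ?case
    using koch_graph_endpoints_weak(2)[OF one] koch_graph_bounds[OF one] by (simp add: dist_norm norm_minus_commute)
next
  case (step z t i)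
  have G: "(koch_map i z, (real i + t) / 4) \<in> koch_graph"
    using step.hyps by (rule koch_graph.step)
  from step.prems show ?case
  proof cases
    case zero
    then show ?thesis
      using koch_graph_endpoints_weak(1)[OF G] koch_graph_bounds[OF G] by (simp add: dist_norm norm_minus_commute)
  next
    case one
    then show ?thesis
      using koch_graph_endpoints_weak(2)[OF G] koch_graph_bounds[OF G] by (simp add: dist_norm norm_minus_commute)
  next
    case (step w' u' j)
    consider "i < j" | "j < i" | "i = j" by linarith
    then show ?thesis
    proof cases
      case 1
      then show ?thesis
        using koch_graph_holder_pieces[OF \<open>(z, t) \<in> koch_graph\<close> step(3) 1] step(4) by (simp only: step(1,2))
    next
      case 2
      then show ?thesis
        using koch_graph_holder_pieces[OF step(3) \<open>(z, t) \<in> koch_graph\<close> 2 \<open>i < 4\<close>]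
        by (simp only: step(1,2) abs_minus_commute dist_commute)
    next
      case 3
      have "\<bar>t - u'\<bar> \<le> 128 * dist z w' powr koch_dim"
        using step(3) by (rule \<open>\<And>w u. (w, u) \<in> koch_graph \<Longrightarrow> _\<close>)
      moreover have "\<bar>(real i + t) / 4 - u\<bar> = \<bar>t - u'\<bar> / 4"
        using step(2) 3 by (simp add: field_simps)
      moreover have "dist (koch_map i z) w = dist z w' / 3"
        by (simp only: step(1) 3 dist_koch_map)
      ultimately show ?thesis
        by (simp only: powr_koch_dim_scale zero_le_dist) simp
    qed
  qed
qed

section \<open>The closed graph and its two projections\<close>

lemma le_zero_if_le_power_third:
  fixes x c :: real
  assumes "\<And>n. x \<le> c / 3 ^ n"
  shows "x \<le> 0"
proof (rule ccontr)
  assume "\<not> x \<le> 0"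
  then have "0 < x" by simp
  have "0 < c" using assms[of 0] \<open>0 < x\<close> by simp
  then obtain n where "(1/3) ^ n < x / c"
    using real_arch_pow_inv[of "x / c" "1/3"] \<open>0 < x\<close> by auto
  then show False
    using assms[of n] \<open>0 < c\<close> by (simp add: field_simps)
qed

text \<open>A relation, since single-valuedness is only proved later: \<open>koch_rel_holder\<close>
  makes the parameter a function of the point, \<open>koch_rel_unique\<close> the point a function
  of the parameter.\<close>

definition koch_rel :: "(complex \<times> real) set" where
  "koch_rel = closure koch_graph"

lemma continuous_on_koch_map: "continuous_on A (koch_map i)"
  by (rule continuous_on_iff[THEN iffD2]) (auto simp: dist_koch_map intro!: exI[of _ "3 * _"])

lemma koch_triangle_norm_le: "z \<in> koch_triangle \<Longrightarrow> norm z \<le> 2"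
  using norm_triangle[of z] Im_triangle[of z] by linarith

lemma koch_rel_subset: "koch_rel \<subseteq> koch_triangle \<times> {0..1}"
proof -
  have "closed koch_triangle"
    unfolding koch_triangle_def
    by (intro closed_Collect_conj closed_Collect_le continuous_intros)
  then show ?thesis
    unfolding koch_rel_def using koch_graph_bounds
    by (intro closure_minimal closed_Times) auto
qed

lemma compact_koch_rel: "compact koch_rel"
proof -
  have "koch_rel \<subseteq> cball 0 2 \<times> {0..1}"
    using koch_rel_subset koch_triangle_norm_le by force
  then have "bounded koch_rel"
    by (rule bounded_subset[rotated]) (intro bounded_Times, auto)
  then show ?thesis
    by (simp add: compact_eq_bounded_closed koch_rel_def)
qed

lemma koch_rel_holder:
  assumes "(z, t) \<in> koch_rel" "(w, u) \<in> koch_rel"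
  shows "\<bar>t - u\<bar> \<le> 128 * dist z w powr koch_dim"
proof -
  let ?S = "{p. \<bar>snd (fst p) - snd (snd p)\<bar> \<le> 128 * dist (fst (fst p)) (fst (snd p)) powr koch_dim}
    :: ((complex \<times> real) \<times> (complex \<times> real)) set"
  have "closed ?S"
    by (intro closed_Collect_le continuous_intros continuous_on_powr') auto
  then have "closure (koch_graph \<times> koch_graph) \<subseteq> ?S"
    using koch_graph_holder by (intro closure_minimal) auto
  then show ?thesis
    using assms by (auto simp: closure_Times koch_rel_def)
qed

lemma continuous_on_koch_step: "continuous_on A (\<lambda>p. (koch_map i (fst p), (real i + snd p) / 4))"
  by (intro continuous_intros continuous_on_compose2[OF continuous_on_koch_map]) auto

lemma koch_rel_step:
  assumes "(z, t) \<in> koch_rel" "i < 4"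
  shows "(koch_map i z, (real i + t) / 4) \<in> koch_rel"
proof -
  have "(\<lambda>p. (koch_map i (fst p), (real i + snd p) / 4)) ` closure koch_graph \<subseteq> closure koch_graph"
    using assms(2) closure_subset[of koch_graph]
    by (intro image_closure_subset continuous_on_koch_step) (auto intro: koch_graph.step)
  then show ?thesis
    using assms(1) by (force simp: koch_rel_def)
qed

text \<open>Recovers the case analysis that the closure destroys. The four images of the compact set
  \<open>koch_rel\<close> form a closed set, and it contains the graph because the base pairs are
  fixed by the steps with index 0 and 3.\<close>

lemma koch_rel_cases:
  assumes "(z, t) \<in> koch_rel"
  obtains i w u where "i < 4" "(w, u) \<in> koch_rel" "z = koch_map i w" "t = (real i + u) / 4"
proof -
  let ?F = "\<lambda>i p. (koch_map i (fst p), (real i + snd p) / 4)"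
  have sub: "koch_graph \<subseteq> koch_rel" by (simp add: koch_rel_def closure_subset)
  have mem: "q \<in> (\<Union>i<4. ?F i ` koch_rel)" if "i < 4" "p \<in> koch_graph" "q = ?F i p" for i p q
    using that sub by (intro UN_I[of i] image_eqI[of _ _ p]) auto
  have "koch_graph \<subseteq> (\<Union>i<4. ?F i ` koch_rel)"
  proof (intro subrelI)
    fix z t assume "(z, t) \<in> koch_graph"
    then show "(z, t) \<in> (\<Union>i<4. ?F i ` koch_rel)"
    proof cases
      case zero
      then show ?thesis using koch_graph.zero by (intro mem[of 0 "(0, 0)"]) (auto simp: koch_map_0_0)
    next
      case one
      then show ?thesis using koch_graph.one by (intro mem[of 3 "(1, 1)"]) (auto simp: koch_map_3_1)
    next
      case (step w u i)
      then show ?thesis by (intro mem[of i "(w, u)"]) auto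
    qed
  qed
  moreover have "closed (?F i ` koch_rel)" for i
    by (intro compact_imp_closed compact_continuous_image continuous_on_koch_step compact_koch_rel)
  then have "closed (\<Union>i<4. ?F i ` koch_rel)"
    by (intro closed_UN) auto
  ultimately have "koch_rel \<subseteq> (\<Union>i<4. ?F i ` koch_rel)"
    unfolding koch_rel_def by (rule closure_minimal)
  then obtain i p where "i < 4" "p \<in> koch_rel" "(z, t) = ?F i p"
    using assms by blast
  then show thesis
    using that[of i "fst p" "snd p"] by auto
qed

lemma fst_koch_rel: "fst ` koch_rel = koch_curve"
proof
  show "fst ` koch_rel \<subseteq> koch_curve"
    unfolding koch_rel_def koch_curve_def koch_points_eq
    by (intro image_closure_subset continuous_intros) (auto intro: closure_subset[THEN subsetD])
  have "koch_points \<subseteq> fst ` koch_rel"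
    unfolding koch_points_eq koch_rel_def using closure_subset by (rule image_mono)
  moreover have "closed (fst ` koch_rel)"
    by (intro compact_imp_closed compact_continuous_image compact_koch_rel continuous_intros)
  ultimately show "koch_curve \<subseteq> fst ` koch_rel"
    unfolding koch_curve_def by (rule closure_minimal)
qed

lemma snd_koch_rel: "snd ` koch_rel = {0..1}"
proof
  show "snd ` koch_rel \<subseteq> {0..1}" using koch_rel_subset by auto
  \<comment> \<open>Each digit improves the error by the factor 4; powers of 3 are claimed so that
    \<open>le_zero_if_le_power_third\<close> applies.\<close>
  have approx: "\<exists>u \<in> snd ` koch_rel. \<bar>t - u\<bar> \<le> 1 / 3 ^ n" if "0 \<le> t" "t \<le> 1" for t n
    using that
  proof (induction n arbitrary: t)
    case 0
    have "(0, 0) \<in> koch_rel"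
      using koch_graph.zero closure_subset by (auto simp: koch_rel_def)
    then have "0 \<in> snd ` koch_rel" by force
    then show ?case using 0 by (intro bexI[of _ 0]) auto
  next
    case (Suc n)
    \<comment> \<open>The leading base-4 digit. At \<open>t = 1\<close> the floor would be 4, so the
      digit 3 is used.\<close>
    have "\<exists>i<4. real i \<le> 4 * t \<and> 4 * t \<le> real i + 1"
    proof (cases "t < 1")
      case True
      with Suc.prems have "nat \<lfloor>4 * t\<rfloor> < 4" "real (nat \<lfloor>4 * t\<rfloor>) \<le> 4 * t" "4 * t \<le> real (nat \<lfloor>4 * t\<rfloor>) + 1"
        by linarith+
      then show ?thesis by blast
    qed (use Suc.prems in \<open>auto intro!: exI[of _ 3]\<close>)
    then obtain i where i: "i < 4" "real i \<le> 4 * t" "4 * t \<le> real i + 1" by blast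
    then obtain u where u: "u \<in> snd ` koch_rel" "\<bar>(4 * t - real i) - u\<bar> \<le> 1 / 3 ^ n"
      using Suc.IH[of "4 * t - real i"] by auto
    then have "(real i + u) / 4 \<in> snd ` koch_rel"
      using koch_rel_step i(1) by force
    moreover have "\<bar>t - (real i + u) / 4\<bar> = \<bar>(4 * t - real i) - u\<bar> / 4"
      by (simp add: field_simps)
    then have "\<bar>t - (real i + u) / 4\<bar> \<le> (1 / 3 ^ n) / 4"
      using u(2) by simp
    then have "\<bar>t - (real i + u) / 4\<bar> \<le> 1 / 3 ^ Suc n"
      by (rule order_trans) (simp add: field_simps)
    ultimately show ?case by blast
  qed
  have closed: "closed (snd ` koch_rel)"
    by (intro compact_imp_closed compact_continuous_image compact_koch_rel continuous_intros)
  show "{0..1} \<subseteq> snd ` koch_rel"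
  proof
    fix t :: real assume t: "t \<in> {0..1}"
    have "infdist t (snd ` koch_rel) \<le> 1 / 3 ^ n" for n
    proof -
      obtain u where "u \<in> snd ` koch_rel" "dist t u \<le> 1 / 3 ^ n"
        using approx[of t n] t by (auto simp: dist_real_def)
      then show ?thesis by (rule infdist_le2)
    qed
    then have "infdist t (snd ` koch_rel) \<le> 0"
      by (rule le_zero_if_le_power_third)
    moreover have "snd ` koch_rel \<noteq> {}" using approx[of 0 0] by auto
    ultimately show "t \<in> snd ` koch_rel"
      using closed infdist_nonneg[of t] by (metis in_closed_iff_infdist_zero order_antisym)
  qed
qed

lemma koch_curve_bounds:
  assumes "z \<in> koch_curve"
  shows "z \<in> koch_triangle"
  using assms koch_rel_subset unfolding fst_koch_rel[symmetric] by auto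

text \<open>Parameter 0 forces the digit 0 and again the parameter 0 at every level, so
  \<open>z\<close> lies in all iterated images under a contraction that fixes 0.\<close>

lemma koch_rel_0:
  assumes "(z, 0) \<in> koch_rel"
  shows "z = 0"
proof -
  have "norm z \<le> 2 / 3 ^ n" if "(z, 0) \<in> koch_rel" for z n
    using that
  proof (induction n arbitrary: z)
    case 0
    then show ?case using koch_rel_subset koch_triangle_norm_le by auto
  next
    case (Suc n)
    from Suc.prems show ?case
    proof (cases rule: koch_rel_cases)
      case (1 i w u)
      then have "0 \<le> u" using koch_rel_subset by auto
      with 1 have "i = 0" "u = 0" by auto
      with 1 Suc.IH[of w] show ?thesis
        using dist_koch_map[of 0 w 0] by (simp add: koch_map_0_0)
    qed
  qed
  then have "norm z \<le> 0"
    using assms by (intro le_zero_if_le_power_third) auto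
  then show ?thesis by simp
qed

lemma koch_rel_1:
  assumes "(z, 1) \<in> koch_rel"
  shows "z = 1"
proof -
  have "dist z 1 \<le> 3 / 3 ^ n" if "(z, 1) \<in> koch_rel" for z n
    using that
  proof (induction n arbitrary: z)
    case 0
    then have "norm z \<le> 2" using koch_rel_subset koch_triangle_norm_le by auto
    then show ?case using norm_triangle_ineq4[of z 1] by (simp add: dist_norm)
  next
    case (Suc n)
    from Suc.prems show ?case
    proof (cases rule: koch_rel_cases)
      case (1 i w u)
      then have "u \<le> 1" using koch_rel_subset by auto
      with 1 have "i = 3" "u = 1" by auto
      with 1 Suc.IH[of w] show ?thesis
        using dist_koch_map[of 3 w 1] by (simp add: koch_map_3_1)
    qed
  qed
  then have "dist z 1 \<le> 0"
    using assms by (intro le_zero_if_le_power_third) auto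
  then show ?thesis by simp
qed

text \<open>Two expansions of one number with different leading digits must be of the form i + 1 =
  (i + 1) + 0, which is the parameter of a junction.\<close>

lemma koch_rel_pieces_meet:
  assumes "(z, t) \<in> koch_rel" "(w, u) \<in> koch_rel" "i < j" "j < 4" "(real i + t) / 4 = (real j + u) / 4"
  shows "koch_map i z = koch_map j w"
proof -
  have "0 \<le> u" "t \<le> 1" using assms(1,2) koch_rel_subset by auto
  moreover have "real i + t = real j + u" "real i + 1 \<le> real j" using assms(3,5) by auto
  ultimately have "t = 1" "u = 0" "j = Suc i" by auto
  then show ?thesis
    using assms koch_rel_0[of w] koch_rel_1[of z] koch_map_junction[of i] by auto
qed

text \<open>Equal leading digits reduce the distance to a third of that of the preimages; different
  ones already force equality.\<close>

lemma koch_rel_unique: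
  assumes "(z, t) \<in> koch_rel" "(w, t) \<in> koch_rel"
  shows "z = w"
proof -
  have "dist z w \<le> 4 / 3 ^ n" if "(z, t) \<in> koch_rel" "(w, t) \<in> koch_rel" for z w t n
    using that
  proof (induction n arbitrary: z w t)
    case 0
    then have "norm z \<le> 2" "norm w \<le> 2" using koch_rel_subset koch_triangle_norm_le by auto
    then show ?case using norm_triangle_ineq4[of z w] by (simp add: dist_norm)
  next
    case (Suc n)
    obtain i z' t1 where z: "i < 4" "(z', t1) \<in> koch_rel" "z = koch_map i z'" "t = (real i + t1) / 4"
      using Suc.prems(1) by (rule koch_rel_cases)
    obtain j w' t2 where w: "j < 4" "(w', t2) \<in> koch_rel" "w = koch_map j w'" "t = (real j + t2) / 4"
      using Suc.prems(2) by (rule koch_rel_cases)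
    consider "i < j" | "j < i" | "i = j" by linarith
    then show ?case
    proof cases
      case 1
      then have "z = w" using koch_rel_pieces_meet[OF z(2) w(2) 1 w(1)] z w by simp
      then show ?thesis by simp
    next
      case 2
      then have "w = z" using koch_rel_pieces_meet[OF w(2) z(2) 2 z(1)] z w by simp
      then show ?thesis by simp
    next
      case 3
      then have "t1 = t2" using z w by simp
      then show ?thesis using Suc.IH[of z' t1 w'] z w 3 by (simp add: dist_koch_map)
    qed
  qed
  then have "dist z w \<le> 0"
    using assms by (intro le_zero_if_le_power_third) auto
  then show ?thesis by simp
qed

lemma koch_curve_subset: "koch_curve \<subseteq> (\<Union>i<4. koch_map i ` koch_curve)"
proof
  fix z assume "z \<in> koch_curve"
  then obtain t where "(z, t) \<in> koch_rel" by (auto simp: fst_koch_rel[symmetric])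
  then show "z \<in> (\<Union>i<4. koch_map i ` koch_curve)"
    by (rule koch_rel_cases) (force simp: fst_koch_rel[symmetric])
qed

section \<open>Finiteness and positivity of the Hausdorff measure\<close>

lemma compact_koch_curve: "compact koch_curve"
  unfolding fst_koch_rel[symmetric]
  by (intro compact_continuous_image compact_koch_rel continuous_intros)

text \<open>Going one scale down replaces the curve by four copies, each weighted by
  \<open>(1/3) powr koch_dim = 1/4\<close>, so the bound never grows. The initial 4 bounds the
  diameter.\<close>

lemma hausdorff_delta_koch_curve: "hausdorff_delta koch_dim (4 / 3 ^ n) koch_curve \<le> ennreal (4 powr koch_dim)"
proof (induction n)
  case 0
  have "diameter koch_curve \<le> 4"
  proof (rule diameter_le)
    fix x y assume "x \<in> koch_curve" "y \<in> koch_curve"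
    then have "norm x \<le> 2" "norm y \<le> 2" using koch_curve_bounds koch_triangle_norm_le by auto
    then show "norm (x - y) \<le> 4" using norm_triangle_ineq4[of x y] by linarith
  qed simp
  then have "hausdorff_delta koch_dim (4 / 3 ^ 0) koch_curve \<le> ennreal (diameter koch_curve powr koch_dim)"
    by (intro hausdorff_delta_le_diameter compact_imp_bounded compact_koch_curve) auto
  also have "\<dots> \<le> ennreal (4 powr koch_dim)"
    using \<open>diameter koch_curve \<le> 4\<close> diameter_ge_0[OF compact_imp_bounded[OF compact_koch_curve]]
    by (intro ennreal_leI powr_mono2) auto
  finally show ?case .
next
  case (Suc n)
  let ?H = "hausdorff_delta koch_dim (4 / 3 ^ n) koch_curve"
  have "hausdorff_delta koch_dim (4 / 3 ^ Suc n) koch_curve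
      \<le> hausdorff_delta koch_dim (4 / 3 ^ Suc n) (\<Union>i<4. koch_map i ` koch_curve)"
    by (intro hausdorff_delta_mono koch_curve_subset)
  also have "\<dots> \<le> (\<Sum>i<4. hausdorff_delta koch_dim (4 / 3 ^ Suc n) (koch_map i ` koch_curve))"
    by (intro hausdorff_delta_UN_finite) auto
  also have "\<dots> \<le> (\<Sum>i<(4::nat). ennreal (1 / 4) * ?H)"
  proof (intro sum_mono)
    fix i
    have "hausdorff_delta koch_dim (1 / 3 * (4 / 3 ^ n)) (koch_map i ` koch_curve)
        \<le> ennreal ((1 / 3) powr koch_dim) * ?H"
      by (intro hausdorff_delta_image) (auto simp: dist_koch_map)
    then show "hausdorff_delta koch_dim (4 / 3 ^ Suc n) (koch_map i ` koch_curve) \<le> ennreal (1 / 4) * ?H"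
      using powr_koch_dim_scale[of 1] by simp
  qed
  also have "\<dots> = ?H"
  proof -
    have "(\<Sum>i<(4::nat). ennreal (1 / 4) * ?H) = ennreal 4 * (ennreal (1 / 4) * ?H)"
      by simp
    also have "\<dots> = ?H"
      unfolding mult.assoc[symmetric] by (subst ennreal_mult[symmetric]) auto
    finally show ?thesis .
  qed
  also note Suc.IH
  finally show ?case .
qed

lemma hausdorff_outer_koch_curve_finite: "hausdorff_outer koch_dim koch_curve < \<infinity>"
proof -
  have "hausdorff_outer koch_dim koch_curve \<le> ennreal (4 powr koch_dim)"
  proof (rule hausdorff_outer_least)
    fix \<delta> :: real assume "0 < \<delta>"
    then obtain n where "4 / 3 ^ n \<le> \<delta>"
      using le_zero_if_le_power_third[of \<delta> 4] by (meson linear not_le)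
    then show "hausdorff_delta koch_dim \<delta> koch_curve \<le> ennreal (4 powr koch_dim)"
      using hausdorff_delta_koch_curve[of n] hausdorff_delta_antimono by (meson order_trans)
  qed
  then show ?thesis using le_less_trans by fastforce
qed

text \<open>Mass distribution principle: the inverse of the parametrization is Hoelder continuous with
  exponent \<open>koch_dim\<close>, so it transports covers of \<open>A\<close> to covers of its image by intervals of
  comparable total length.\<close>

lemma hausdorff_outer_ge_image_length:
  assumes "a \<le> b" "{a..b} \<subseteq> koch_rel `` A"
  shows "ennreal (b - a) \<le> 256 * hausdorff_outer koch_dim A"
proof -
  have "ennreal (b - a) / 256 \<le> hausdorff_delta koch_dim 1 A"
  proof (rule hausdorff_delta_greatest)
    fix U :: "nat \<Rightarrow> complex set"
    assume U: "A \<subseteq> (\<Union>n. U n)" "\<And>n. bounded (U n)"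
    \<comment> \<open>By the Hoelder bound all parameters of points in \<open>U n\<close> lie within
      \<open>r n\<close> of any one of them; the interval of length \<open>2 * r n\<close> accounts
      for the constant 256.\<close>
    define r where "r n = 128 * diameter (U n) powr koch_dim" for n
    have "\<exists>c. koch_rel `` U n \<subseteq> {c - r n..c + r n}" for n
    proof (cases "koch_rel `` U n = {}")
      case False
      then obtain z c where zc: "z \<in> U n" "(z, c) \<in> koch_rel" by auto
      have "\<bar>t - c\<bar> \<le> r n" if "w \<in> U n" "(w, t) \<in> koch_rel" for w t
      proof -
        have "dist w z powr koch_dim \<le> diameter (U n) powr koch_dim"
          using diameter_bounded_bound[OF U(2) that(1) zc(1)] by (intro powr_mono2) auto
        then show ?thesis
          using koch_rel_holder[OF that(2) zc(2)] by (simp add: r_def)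
      qed
      then show ?thesis by (intro exI[of _ c]) (fastforce simp: abs_le_iff)
    qed auto
    then obtain c where c: "\<And>n. koch_rel `` U n \<subseteq> {c n - r n..c n + r n}" by metis
    have "ennreal (b - a) = emeasure lborel {a..b}"
      using assms(1) by simp
    also have "\<dots> \<le> emeasure lborel (\<Union>n. {c n - r n..c n + r n})"
    proof (rule emeasure_mono)
      show "{a..b} \<subseteq> (\<Union>n. {c n - r n..c n + r n})"
        using assms(2) U(1) c by blast
      show "(\<Union>n. {c n - r n..c n + r n}) \<in> sets lborel"
        by (intro sets.countable_UN) auto
    qed
    also have "\<dots> \<le> (\<Sum>n. emeasure lborel {c n - r n..c n + r n})"
      by (intro emeasure_subadditive_countably) auto
    also have "\<dots> = (\<Sum>n. 256 * ennreal (diameter (U n) powr koch_dim))"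
      by (intro suminf_cong) (simp add: r_def ennreal_mult)
    also have "\<dots> = 256 * (\<Sum>n. ennreal (diameter (U n) powr koch_dim))"
      by simp
    finally show "ennreal (b - a) / 256 \<le> (\<Sum>n. ennreal (diameter (U n) powr koch_dim))"
      by (intro divide_le_posI_ennreal) auto
  qed
  also have "\<dots> \<le> hausdorff_outer koch_dim A"
    by (intro hausdorff_delta_le_outer) simp
  finally have "256 * (ennreal (b - a) / 256) \<le> 256 * hausdorff_outer koch_dim A"
    by (rule mult_left_mono) simp
  then show ?thesis
    by (simp add: ennreal_times_divide mult.commute[of 256] ennreal_mult_divide_eq)
qed

text \<open>Self-similarity takes the place of continuity of the parametrization. Around the fixed
  points 0 and 1 the whole parameter interval is contracted into arbitrarily small balls; further
  steps carry these intervals to all 4-adic points.\<close>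

lemma koch_points_interval:
  assumes "(p, t) \<in> koch_graph" "0 < r"
  shows "\<exists>a b. a < b \<and> {a..b} \<subseteq> koch_rel `` ball p r"
proof -
  have contract: "\<exists>a b. a < b \<and> {a..b} \<subseteq> koch_rel `` ball (koch_map i p) r"
    if i: "i < 4" and ex: "\<exists>a b. a < b \<and> {a..b} \<subseteq> koch_rel `` ball p (3 * r)" for p r i
  proof -
    obtain a b where ab: "a < b" "{a..b} \<subseteq> koch_rel `` ball p (3 * r)" using ex by blast
    have "{(real i + a) / 4..(real i + b) / 4} \<subseteq> koch_rel `` ball (koch_map i p) r"
    proof
      fix u assume "u \<in> {(real i + a) / 4..(real i + b) / 4}"
      then have "4 * u - real i \<in> {a..b}" by (auto simp: field_simps)
      then obtain z where z: "dist p z < 3 * r" "(z, 4 * u - real i) \<in> koch_rel"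
        using ab(2) by fastforce
      then have "(koch_map i z, u) \<in> koch_rel"
        using koch_rel_step[OF z(2) i] by simp
      moreover have "koch_map i z \<in> ball (koch_map i p) r"
        using z(1) by (simp add: dist_koch_map)
      ultimately show "u \<in> koch_rel `` ball (koch_map i p) r" by blast
    qed
    with ab(1) show ?thesis by (intro exI[of _ "(real i + a) / 4"] exI[of _ "(real i + b) / 4"]) auto
  qed
  have fixpoint: "\<exists>a b. a < b \<and> {a..b} \<subseteq> koch_rel `` ball p r"
    if p: "koch_map i p = p" "i < 4" "norm p \<le> 2" and r: "0 < r" for p r i
  proof -
    \<comment> \<open>Radius 5 suffices at the start, as \<open>p\<close> and all points of the
      curve have norm at most 2.\<close>
    have *: "\<exists>a b. a < b \<and> {a..b} \<subseteq> koch_rel `` ball p (5 / 3 ^ n)" for n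
    proof (induction n)
      case 0
      have "u \<in> koch_rel `` ball p 5" if u: "u \<in> {0..1}" for u
      proof -
        obtain z where z: "(z, u) \<in> koch_rel" using u snd_koch_rel by fastforce
        then have "norm z \<le> 2" using koch_rel_subset koch_triangle_norm_le by auto
        then have "z \<in> ball p 5" using p(3) norm_triangle_ineq4[of p z] by (simp add: dist_norm)
        with z show ?thesis by blast
      qed
      then show ?case by (intro exI[of _ 0] exI[of _ 1]) auto
    next
      case (Suc n)
      then show ?case using contract[OF p(2), of p "5 / 3 ^ Suc n"] p(1) by simp
    qed
    obtain n where "5 / 3 ^ n \<le> r"
      using le_zero_if_le_power_third[of r 5] r by (meson linear not_le)
    then show ?thesis using *[of n] subset_ball[of "5 / 3 ^ n" r p] by (meson Image_mono order_refl order_trans)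
  qed
  from assms show ?thesis
  proof (induction arbitrary: r)
    case zero
    then show ?case using fixpoint[of 0 0] koch_map_0_0 by simp
  next
    case one
    then show ?case using fixpoint[of 3 1] koch_map_3_1 by simp
  next
    case (step z t i)
    then show ?case using contract[OF \<open>i < 4\<close>, of z r] by simp
  qed
qed

lemma hausdorff_outer_koch_ball_pos:
  assumes "z \<in> koch_curve" "0 < r"
  shows "0 < hausdorff_outer koch_dim (ball z r \<inter> koch_curve)"
proof -
  obtain p where p: "p \<in> koch_points" "dist p z < r / 2"
    using assms(1) half_gt_zero[OF assms(2)] unfolding koch_curve_def closure_approachable by blast
  then obtain t where "(p, t) \<in> koch_graph" by (auto simp: koch_points_eq)
  then obtain a b where ab: "a < b" "{a..b} \<subseteq> koch_rel `` ball p (r / 2)"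
    using koch_points_interval[of p t "r / 2"] assms(2) by auto
  have "ball p (r / 2) \<subseteq> ball z r"
  proof
    fix w assume "w \<in> ball p (r / 2)"
    then show "w \<in> ball z r" using p(2) dist_triangle[of z w p] by (simp add: dist_commute)
  qed
  moreover have "koch_rel `` ball z r = koch_rel `` (ball z r \<inter> koch_curve)"
    by (force simp: fst_koch_rel[symmetric])
  ultimately have "{a..b} \<subseteq> koch_rel `` (ball z r \<inter> koch_curve)"
    using ab(2) by blast
  then have "ennreal (b - a) \<le> 256 * hausdorff_outer koch_dim (ball z r \<inter> koch_curve)"
    using ab(1) by (intro hausdorff_outer_ge_image_length) auto
  moreover have "0 < ennreal (b - a)" using ab(1) by simp
  ultimately show ?thesis
    by (metis less_le_trans mult_zero_right zero_less_iff_neq_zero)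
qed

section \<open>Absence of rectifiable curves and the snowflake\<close>

lemma arclength_curve_dist_le:
  assumes "arclength_curve P \<gamma> l" "0 \<le> x" "x \<le> y" "y \<le> l"
  shows "dist (\<gamma> x) (\<gamma> y) \<le> y - x"
proof -
  let ?p = "(1 :: nat, \<lambda>i::nat. if i = 0 then x else y)"
  have "ereal (\<Sum>i<fst ?p. dist (\<gamma> (snd ?p i)) (\<gamma> (snd ?p (Suc i)))) \<le> curve_length \<gamma> x y"
    unfolding curve_length_def using assms(3) by (intro SUP_upper) auto
  also have "\<dots> = ereal (y - x)"
    using assms by (auto simp: arclength_curve_def)
  finally show ?thesis by simp
qed

lemma curve_length_const_le:
  assumes "\<And>x. x \<in> {a..b} \<Longrightarrow> \<gamma> x = c"
  shows "curve_length \<gamma> a b \<le> 0"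
  unfolding curve_length_def
proof (rule SUP_least)
  fix p :: "nat \<times> (nat \<Rightarrow> real)"
  assume "p \<in> {p. snd p 0 = a \<and> snd p (fst p) = b \<and> (\<forall>i<fst p. snd p i \<le> snd p (Suc i))}"
  then obtain n q where p: "p = (n, q)" "q 0 = a" "q n = b" "\<And>i. i < n \<Longrightarrow> q i \<le> q (Suc i)"
    by (cases p) auto
  have mono: "q i \<le> q j" if "i \<le> j" "j \<le> n" for i j
    using that
  proof (induction rule: dec_induct)
    case (step k)
    then show ?case using p(4)[of k] by simp
  qed simp
  have "\<gamma> (q i) = c" if "i \<le> n" for i
    using assms mono[of 0 i] mono[of i n] that p by auto
  then show "ereal (\<Sum>i<fst p. dist (\<gamma> (snd p i)) (\<gamma> (snd p (Suc i)))) \<le> 0"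
    by (simp add: p)
qed

text \<open>Difference quotients are bounded by \<open>C * \<bar>x - y\<bar> powr (s - 1)\<close>,
  which tends to 0, so the derivative vanishes.\<close>

lemma holder_gt_1_imp_const:
  fixes f :: "real \<Rightarrow> real"
  assumes "1 < s" "a \<le> b" "\<And>x y. x \<in> {a..b} \<Longrightarrow> y \<in> {a..b} \<Longrightarrow> \<bar>f x - f y\<bar> \<le> C * \<bar>x - y\<bar> powr s"
  shows "x \<in> {a..b} \<Longrightarrow> f x = f a"
proof -
  have "(f has_field_derivative 0) (at x within {a..b})" if x: "x \<in> {a..b}" for x
    unfolding has_field_derivative_iff
  proof (rule Lim_null_comparison)
    have "((\<lambda>y. C * \<bar>y - x\<bar> powr (s - 1)) \<longlongrightarrow> C * 0) (at x within {a..b})"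
    proof (intro tendsto_mult tendsto_const)
      have "((\<lambda>y. \<bar>y - x\<bar> powr (s - 1)) \<longlongrightarrow> \<bar>x - x\<bar> powr (s - 1)) (at x within {a..b})"
        using assms(1) by (intro tendsto_powr' tendsto_intros) auto
      then show "((\<lambda>y. \<bar>y - x\<bar> powr (s - 1)) \<longlongrightarrow> 0) (at x within {a..b})" by simp
    qed
    then show "((\<lambda>y. C * \<bar>y - x\<bar> powr (s - 1)) \<longlongrightarrow> 0) (at x within {a..b})" by simp
    show "\<forall>\<^sub>F y in at x within {a..b}. norm ((f y - f x) / (y - x)) \<le> C * \<bar>y - x\<bar> powr (s - 1)"
      unfolding eventually_at_filter
    proof (intro always_eventually allI impI)
      fix y assume "y \<noteq> x" "y \<in> {a..b}"
      then have "\<bar>f y - f x\<bar> / \<bar>y - x\<bar> \<le> C * \<bar>y - x\<bar> powr s / \<bar>y - x\<bar>"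
        using assms(3) x by (intro divide_right_mono) auto
      also have "\<dots> = C * \<bar>y - x\<bar> powr (s - 1)"
        using \<open>y \<noteq> x\<close> by (simp add: powr_diff)
      finally show "norm ((f y - f x) / (y - x)) \<le> C * \<bar>y - x\<bar> powr (s - 1)" by simp
    qed
  qed
  then obtain c where "\<forall>x\<in>{a..b}. f x = c"
    using has_field_derivative_zero_constant[of "{a..b}" f] by auto
  then show "f x = f a" if "x \<in> {a..b}" using that assms(2) by auto
qed

text \<open>An elementary finite form of the Baire argument: either one set contains the open
  interval, or its complement leaves a smaller interval to the remaining sets.\<close>

lemma interval_finite_closed_cover:
  fixes C :: "'i \<Rightarrow> real set"
  assumes "finite I" "\<And>i. i \<in> I \<Longrightarrow> closed (C i)" "a < b" "{a..b} \<subseteq> (\<Union>i\<in>I. C i)"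
  shows "\<exists>i\<in>I. \<exists>c d. a \<le> c \<and> c < d \<and> d \<le> b \<and> {c..d} \<subseteq> C i"
  using assms
proof (induction I arbitrary: a b rule: finite_induct)
  case (insert i I)
  show ?case
  proof (cases "{a<..<b} \<subseteq> C i")
    case True
    \<comment> \<open>Only the open interval is known to lie in \<open>C i\<close>; its closed
      middle third has the required form.\<close>
    then have "{(2 * a + b) / 3..(a + 2 * b) / 3} \<subseteq> C i"
      using insert.prems(2) by (auto intro!: subsetD[OF True])
    then show ?thesis
      using insert.prems(2) by (intro bexI[of _ i] exI[of _ "(2 * a + b) / 3"] exI[of _ "(a + 2 * b) / 3"]) auto
  next
    case False
    then obtain x where x: "x \<in> {a<..<b} - C i" by blast
    moreover have "open ({a<..<b} - C i)"
      using insert.prems(1) by (intro open_Diff) auto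
    ultimately obtain e where e: "0 < e" "cball x e \<subseteq> {a<..<b} - C i"
      by (meson open_contains_cball)
    then have sub: "{x - e..x + e} \<subseteq> {a<..<b} - C i"
      by (simp add: cball_eq_atLeastAtMost)
    have "{a<..<b} - C i \<subseteq> (\<Union>i\<in>I. C i)"
    proof
      fix y assume y: "y \<in> {a<..<b} - C i"
      then have "y \<in> {a..b}" by simp
      then show "y \<in> (\<Union>i\<in>I. C i)" using insert.prems(3) y by blast
    qed
    then have "{x - e..x + e} \<subseteq> (\<Union>i\<in>I. C i)"
      using sub by simp
    then have "\<exists>i\<in>I. \<exists>c d. x - e \<le> c \<and> c < d \<and> d \<le> x + e \<and> {c..d} \<subseteq> C i"
      using insert.prems(1) e(1) by (intro insert.IH) auto
    then obtain j c d where "j \<in> I" "x - e \<le> c" "c < d" "d \<le> x + e" "{c..d} \<subseteq> C j"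
      by blast
    moreover have "a \<le> x - e" "x + e \<le> b"
      using subsetD[OF sub, of "x - e"] subsetD[OF sub, of "x + e"] e(1) by auto
    ultimately show ?thesis
      by (intro bexI[of _ j] exI[of _ c] exI[of _ d]) auto
  qed
qed auto

section \<open>The snowflake as three isometric copies\<close>

text \<open>The sides of the equilateral triangle with vertices 0, 1 and \<open>cis (-pi/3)\<close>,
  run through clockwise so that each curve bulges outwards.\<close>

definition koch_copy :: "nat \<Rightarrow> complex \<Rightarrow> complex" where
  "koch_copy i z = (if i = 0 then z else if i = 1 then 1 + cis (-2*pi/3) * z
     else cis (-pi/3) + cis (2*pi/3) * z)"

lemma koch_snowflake_eq: "koch_snowflake = (\<Union>i<3. koch_copy i ` koch_curve)"
proof -
  have "{..<3::nat} = {0, 1, 2}" by auto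
  then show ?thesis
    by (simp add: koch_snowflake_def koch_copy_def[abs_def] Un_assoc)
qed

lemma dist_koch_copy: "dist (koch_copy i x) (koch_copy i y) = dist x y"
proof -
  have "dist (a + c * x) (a + c * y) = dist x y" if "norm c = 1" for a c :: complex
    using that unfolding dist_norm by (metis add_diff_cancel_left mult_1 norm_mult right_diff_distrib)
  from this[of "cis _"] show ?thesis
    unfolding koch_copy_def by simp
qed

text \<open>An isometric left inverse allows the one-sided
  \<open>hausdorff_outer_isometry_le\<close> to give lower bounds for the measure of a copy.\<close>

lemma koch_copy_inverse:
  obtains g where "\<And>z. g (koch_copy i z) = z" "\<And>x y. dist (g x) (g y) = dist x y"
proof -
  have "\<exists>g. (\<forall>z. g (a + c * z) = z) \<and> (\<forall>x y. dist (g x) (g y) = dist x y)" if "norm c = 1" for a c :: complex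
  proof (intro exI conjI allI)
    have "c \<noteq> 0" using that by auto
    then show "(a + c * z - a) / c = z" for z by simp
    show "dist ((x - a) / c) ((y - a) / c) = dist x y" for x y
      using that by (simp add: dist_norm norm_divide flip: diff_divide_distrib)
  qed
  from this[of 1 0] this[of "cis _"] have "\<exists>g. (\<forall>z. g (koch_copy i z) = z) \<and> (\<forall>x y. dist (g x) (g y) = dist x y)"
    unfolding koch_copy_def by (cases "i = 0"; cases "i = 1") simp_all
  then show thesis using that by blast
qed

lemma compact_koch_copy: "compact (koch_copy i ` koch_curve)"
proof (rule compact_continuous_image[OF _ compact_koch_curve])
  show "continuous_on koch_curve (koch_copy i)"
    by (rule continuous_on_iff[THEN iffD2]) (auto simp: dist_koch_copy)
qed

lemma compact_koch_snowflake: "compact koch_snowflake"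
  unfolding koch_snowflake_eq by (intro compact_UN) (auto intro: compact_koch_copy)

lemma hausdorff_outer_isometry_le:
  assumes "\<And>x y. dist (f x) (f y) = dist x y" "0 \<le> s"
  shows "hausdorff_outer s (f ` A) \<le> hausdorff_outer s A"
proof (rule hausdorff_outer_least)
  fix \<delta> :: real assume "0 < \<delta>"
  have "hausdorff_delta s (1 * \<delta>) (f ` A) \<le> ennreal (1 powr s) * hausdorff_delta s \<delta> A"
    using assms by (intro hausdorff_delta_image) auto
  also have "\<dots> \<le> hausdorff_outer s A"
    using \<open>0 < \<delta>\<close> by (simp add: hausdorff_delta_le_outer)
  finally show "hausdorff_delta s \<delta> (f ` A) \<le> hausdorff_outer s A" by simp
qed

text \<open>On a parameter interval on which the curve stays in one copy of the Koch curve, composing it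
  with the inverse of the Koch parametrization gives a function that is Hoelder continuous with
  exponent greater than \<open>1\<close>, hence constant.\<close>

lemma nonconst_rect_curves_koch_snowflake: "nonconst_rect_curves koch_snowflake = {}"
proof (rule ccontr)
  assume "nonconst_rect_curves koch_snowflake \<noteq> {}"
  then obtain \<gamma> l where \<gamma>: "arclength_curve koch_snowflake \<gamma> l" "0 < l"
    by (auto simp: nonconst_rect_curves_def)
  then have cont: "continuous_on {0..l} \<gamma>" and img: "\<gamma> ` {0..l} \<subseteq> koch_snowflake"
    by (auto simp: arclength_curve_def)
  \<comment> \<open>The curve may change between copies; the aim is a nondegenerate parameter
    interval on which it stays in one.\<close>
  define C where "C i = {0..l} \<inter> \<gamma> -` (koch_copy i ` koch_curve)" for i
  have "closed (C i)" for i
    unfolding C_def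
    by (intro continuous_closed_preimage cont closed_real_atLeastAtMost compact_imp_closed[OF compact_koch_copy])
  moreover have "{0..l} \<subseteq> (\<Union>i\<in>{..<3}. C i)"
  proof
    fix x assume x: "x \<in> {0..l}"
    then have "\<gamma> x \<in> (\<Union>i<3. koch_copy i ` koch_curve)"
      using img unfolding koch_snowflake_eq by blast
    then show "x \<in> (\<Union>i\<in>{..<3}. C i)"
      using x unfolding C_def by blast
  qed
  ultimately obtain i a b where ab: "0 \<le> a" "a < b" "b \<le> l" "{a..b} \<subseteq> C i"
    using interval_finite_closed_cover[of "{..<3}" C 0 l] \<gamma>(2) by auto
  have "\<exists>z u. \<gamma> x = koch_copy i z \<and> (z, u) \<in> koch_rel" if "x \<in> {a..b}" for x
    using subsetD[OF ab(4) that] by (auto simp: C_def fst_koch_rel[symmetric])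
  then obtain z u where zu: "\<And>x. x \<in> {a..b} \<Longrightarrow> \<gamma> x = koch_copy i (z x)"
      "\<And>x. x \<in> {a..b} \<Longrightarrow> (z x, u x) \<in> koch_rel"
    by metis
  have "\<bar>u x - u y\<bar> \<le> 128 * \<bar>x - y\<bar> powr koch_dim" if "x \<in> {a..b}" "y \<in> {a..b}" for x y
  proof -
    have "dist (z x) (z y) = dist (\<gamma> x) (\<gamma> y)"
      using zu(1) that by (simp add: dist_koch_copy)
    also have "\<dots> \<le> \<bar>x - y\<bar>"
      using arclength_curve_dist_le[OF \<gamma>(1), of x y] arclength_curve_dist_le[OF \<gamma>(1), of y x] that ab
      by (cases "x \<le> y") (auto simp: dist_commute)
    finally have "dist (z x) (z y) powr koch_dim \<le> \<bar>x - y\<bar> powr koch_dim"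
      by (intro powr_mono2) auto
    then show ?thesis
      using koch_rel_holder[OF zu(2)[OF that(1)] zu(2)[OF that(2)]] by simp
  qed
  then have u_eq: "u x = u a" if "x \<in> {a..b}" for x
    by (rule holder_gt_1_imp_const[OF koch_dim_gt_1 less_imp_le[OF ab(2)] _ that])
  \<comment> \<open>The parameters are constant by now; uniqueness of the point with a given
    parameter carries this over to the curve.\<close>
  have z_eq: "z x = z a" if "x \<in> {a..b}" for x
  proof (rule koch_rel_unique)
    show "(z x, u a) \<in> koch_rel" using zu(2)[OF that] u_eq[OF that] by simp
    show "(z a, u a) \<in> koch_rel" using zu(2)[of a] ab(2) by simp
  qed
  then have "\<gamma> x = koch_copy i (z a)" if "x \<in> {a..b}" for x
    using zu(1)[OF that] z_eq[OF that] by simp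
  \<comment> \<open>Parametrization by arc length excludes a constant stretch: its length would be
    both 0 and \<open>b - a\<close>.\<close>
  then have "curve_length \<gamma> a b \<le> 0"
    by (rule curve_length_const_le)
  moreover have "curve_length \<gamma> a b = ereal (b - a)"
    using \<gamma>(1) ab by (auto simp: arclength_curve_def)
  ultimately show False
    using ab(2) by simp
qed

lemma standing_assms_koch_snowflake:
  "standing_assms koch_snowflake (hausdorff_measure_on koch_dim koch_snowflake)"
proof -
  have dim: "0 \<le> koch_dim" and borel: "koch_snowflake \<in> sets borel"
    using compact_koch_snowflake by (auto intro: borel_compact)
  have ball: "ball x r \<inter> koch_snowflake \<in> sets (restrict_space borel koch_snowflake)" for x r
    by (auto simp: sets_restrict_space)
  have pos: "0 < hausdorff_outer koch_dim (ball x r \<inter> koch_snowflake)"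
    if x: "x \<in> koch_snowflake" and r: "0 < r" for x r
  proof -
    obtain i z where iz: "i < 3" "z \<in> koch_curve" "x = koch_copy i z"
      using x by (auto simp: koch_snowflake_eq)
    obtain g where g: "\<And>z. g (koch_copy i z) = z" "\<And>x y. dist (g x) (g y) = dist x y"
      by (rule koch_copy_inverse[of i]) blast
    have "0 < hausdorff_outer koch_dim (ball z r \<inter> koch_curve)"
      using iz r by (intro hausdorff_outer_koch_ball_pos)
    \<comment> \<open>The ball in the Koch curve is recovered from its copy by the isometry
      \<open>g\<close>, which bounds the measure of the copy from below.\<close>
    also have "\<dots> = hausdorff_outer koch_dim (g ` koch_copy i ` (ball z r \<inter> koch_curve))"
      by (simp add: image_image g)
    also have "\<dots> \<le> hausdorff_outer koch_dim (koch_copy i ` (ball z r \<inter> koch_curve))"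
      using dim g(2) by (intro hausdorff_outer_isometry_le)
    also have "\<dots> \<le> hausdorff_outer koch_dim (ball x r \<inter> koch_snowflake)"
      using iz by (intro hausdorff_outer_mono) (auto simp: koch_snowflake_eq dist_koch_copy)
    finally show ?thesis .
  qed
  have "hausdorff_outer koch_dim koch_snowflake \<le> (\<Sum>i<3. hausdorff_outer koch_dim (koch_copy i ` koch_curve))"
    unfolding koch_snowflake_eq by (intro hausdorff_outer_UN_finite) auto
  also have "\<dots> \<le> (\<Sum>i<(3::nat). hausdorff_outer koch_dim koch_curve)"
    using dim by (intro sum_mono hausdorff_outer_isometry_le dist_koch_copy)
  also have "\<dots> < \<infinity>"
    using hausdorff_outer_koch_curve_finite by (simp add: ennreal_mult_less_top)
  finally have "hausdorff_outer koch_dim (ball x r \<inter> koch_snowflake) < \<infinity>" for x r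
    by (rule le_less_trans[OF hausdorff_outer_mono, rotated]) simp
  then show ?thesis
    unfolding standing_assms_def
    using pos ball space_hausdorff_measure_on[OF dim borel] sets_hausdorff_measure_on[OF dim borel]
      complete_hausdorff_measure_on[OF dim borel] emeasure_hausdorff_measure_on[OF dim borel]
    by auto
qed

lemma almost_no_curves_koch_snowflake:
  "almost_no_curves koch_snowflake (hausdorff_measure_on koch_dim koch_snowflake)"
proof
  show "zero_Linf_modulus koch_snowflake (hausdorff_measure_on koch_dim koch_snowflake)
      (nonconst_rect_curves koch_snowflake)"
    unfolding zero_Linf_modulus_def nonconst_rect_curves_koch_snowflake
  \<comment> \<open>With no curve to test against, the zero function is a witness.\<close>
  proof (intro exI[of _ "\<lambda>_. 0"] conjI)
    have "linf_norm (hausdorff_measure_on koch_dim koch_snowflake) (\<lambda>x. enn2ereal 0) \<le> 0"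
      unfolding linf_norm_def by (intro esssup_I) (auto simp: zero_ennreal.rep_eq)
    then show "in_Linf (hausdorff_measure_on koch_dim koch_snowflake) (\<lambda>x. enn2ereal 0)"
      using le_less_trans[of _ 0 "\<infinity>::ereal"] by (simp add: in_Linf_def)
  qed (auto simp: borel_on_def)
  have "0 \<in> koch_curve"
    using koch_points.zero closure_subset by (auto simp: koch_curve_def)
  then show "koch_snowflake \<noteq> {}"
    by (auto simp: koch_snowflake_def)
qed (rule standing_assms_koch_snowflake)

lemma emeasure_koch_snowflake_singleton:
  assumes "x \<in> koch_snowflake"
  shows "emeasure (hausdorff_measure_on koch_dim koch_snowflake) {x} = 0"
proof -
  have "{x} \<in> sets (restrict_space borel koch_snowflake)"
    using assms by (auto simp: sets_restrict_space intro!: image_eqI[of _ _ "{x}"])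
  then show ?thesis
    using compact_koch_snowflake
    by (subst emeasure_hausdorff_measure_on) (auto intro: borel_compact simp: hausdorff_outer_singleton)
qed

theorem theorem1p1:
  shows "(\<forall>(P :: 'a::metric_space set) M x0.
              standing_assms P M \<and> zero_Linf_modulus P M (nonconst_rect_curves P)
              \<and> x0 \<in> P \<and> emeasure M {x0} = 0
            \<longrightarrow> N1Linf P M = Linf M \<and> concl_abc P M x0)
         \<and> standing_assms koch_snowflake (hausdorff_measure_on (ln 4 / ln 3) koch_snowflake)
         \<and> N1Linf koch_snowflake (hausdorff_measure_on (ln 4 / ln 3) koch_snowflake)
             = Linf (hausdorff_measure_on (ln 4 / ln 3) koch_snowflake)
         \<and> (\<forall>x0\<in>koch_snowflake. concl_abc koch_snowflake (hausdorff_measure_on (ln 4 / ln 3) koch_snowflake) x0)"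
proof (intro conjI allI impI ballI)
  fix P :: "'a set" and M x0
  assume *: "standing_assms P M \<and> zero_Linf_modulus P M (nonconst_rect_curves P)
      \<and> x0 \<in> P \<and> emeasure M {x0} = 0"
  \<comment> \<open>The point \<open>x0\<close> provides the nonemptiness of
    \<open>P\<close>.\<close>
  then interpret almost_no_curves P M by unfold_locales auto
  show "N1Linf P M = Linf M" by (rule N1Linf_eq_Linf)
  show "concl_abc P M x0" using * by (intro concl_abc) auto
next
  interpret almost_no_curves koch_snowflake "hausdorff_measure_on koch_dim koch_snowflake"
    by (rule almost_no_curves_koch_snowflake)
  show "standing_assms koch_snowflake (hausdorff_measure_on koch_dim koch_snowflake)"
    by (rule standing)
  show "N1Linf koch_snowflake (hausdorff_measure_on koch_dim koch_snowflake)
      = Linf (hausdorff_measure_on koch_dim koch_snowflake)"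
    by (rule N1Linf_eq_Linf)
  show "concl_abc koch_snowflake (hausdorff_measure_on koch_dim koch_snowflake) x0" if "x0 \<in> koch_snowflake" for x0
    by (rule concl_abc[OF that emeasure_koch_snowflake_singleton[OF that]])
qed

end
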